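(* Let $(v_1, v_2, \ldots, v_k)$ be a $k$-tuple of positive integers such that $\ell c(v_1)-\ell c(v_1-1)\ge \ell c(v_i)-\ell c(v_i-1)$ for all $2\le i\le k$. Then there is a nonnegative integer $N$ with $$N\le \tfrac{1}{5}\log (v_1-1)+\tfrac{1}{5}\sum_{i=2}^k \log (v_i)+10k+4$$ such that for each integer $n\ge N$ there is an orthogonal design $OD\big(2^n\sum_{j=1}^k v_j;\, 2^nv_1, \ldots, 2^nv_k\big)$.
   Context: Here $\log$ is to base $2$, with the convention $\log(0)=0$. An orthogonal design $OD(n;\,u_1,\ldots,u_k)$, with $u_1,\ldots,u_k$ positive integers, is a square matrix $X$ of order $n$ with entries from $\{0,\pm x_1,\ldots,\pm x_k\}$, where $x_1,\ldots,x_k$ are distinct commuting real variables, such that $XX^{t}=\big(\sum_{i=1}^k u_i x_i^2\big)I_n$. A complex Golay number is a positive integer $m$ for which there is a pair of sequences $A=(a_1,\ldots,a_m)$, $B=(b_1,\ldots,b_m)$ with entries in $\{\pm1,\pm i\}\subset\mathbb{C}$ such that $\sum_{r=1}^{m-j}(a_{r+j}\overline{a_r}+b_{r+j}\overline{b_r})=0$ for all $1\le j\le m-1$. For a positive integer $u$, $\ell c(u)$ is the least number of complex Golay numbers (repetitions allowed) that add up to $u$, and $\ell c(0)=0$. *)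

theory Defs
  imports
    Complex_Main
    "HOL-Library.Poly_Mapping"
    "Jordan_Normal_Form.Matrix"
begin

text \<open>
  Real multivariate polynomials: finitely supported maps from monomials (exponent vectors,
  themselves finitely supported) to coefficients. Multiplication on this type is convolution,
  so it is the commutative polynomial ring in the indeterminates \<open>var 0, var 1, \<dots>\<close>.
\<close>

type_synonym real_mpoly = "(nat \<Rightarrow>\<^sub>0 nat) \<Rightarrow>\<^sub>0 real"

definition var :: "nat \<Rightarrow> real_mpoly" where
  "var i = Poly_Mapping.single (Poly_Mapping.single i 1) 1"

text \<open>\<open>X\<close> is an \<open>OD(n; u 1, \<dots>, u k)\<close> in the variables \<open>var 1, \<dots>, var k\<close>.\<close>

definition orthogonal_design :: "nat \<Rightarrow> nat \<Rightarrow> (nat \<Rightarrow> nat) \<Rightarrow> real_mpoly mat \<Rightarrow> bool" where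
  "orthogonal_design n k u X \<longleftrightarrow>
     (\<forall>i\<in>{1..k}. 0 < u i) \<and>
     X \<in> carrier_mat n n \<and>
     (\<forall>r<n. \<forall>c<n. X $$ (r, c) \<in> {0} \<union> var ` {1..k} \<union> (\<lambda>i. - var i) ` {1..k}) \<and>
     X * transpose_mat X = (\<Sum>i=1..k. of_nat (u i) * (var i)\<^sup>2) \<cdot>\<^sub>m 1\<^sub>m n"

definition complex_golay_number :: "nat \<Rightarrow> bool" where
  "complex_golay_number m \<longleftrightarrow> 0 < m \<and>
     (\<exists>a b :: nat \<Rightarrow> complex.
        (\<forall>r\<in>{1..m}. a r \<in> {1, -1, \<i>, -\<i>} \<and> b r \<in> {1, -1, \<i>, -\<i>}) \<and>
        (\<forall>j\<in>{1..m-1}. (\<Sum>r=1..m-j. a (r+j) * cnj (a r) + b (r+j) * cnj (b r)) = 0))"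

text \<open>
  The set of admissible lengths is never empty because 1 is a complex Golay number;
  the empty list gives \<open>lc 0 = 0\<close>.
\<close>

definition lc :: "nat \<Rightarrow> nat" where
  "lc u = (LEAST l. \<exists>ms. length ms = l \<and> (\<forall>m\<in>set ms. complex_golay_number m) \<and> sum_list ms = u)"

definition lg :: "nat \<Rightarrow> real" where
  "lg m = (if m = 0 then 0 else log 2 (real m))"

end

theory Submission
  imports Defs "HOL-Computational_Algebra.Polynomial"
begin

text \<open>
  Write each \<open>v i\<close> as a sum of complex Golay numbers, using \<open>p\<close> of them in total. A Golay pair
  \<open>(a, b)\<close> of length \<open>m\<close>, shifted to its own positions, yields four commuting Hermitian circulants
  \<open>a + a*\<close>, \<open>\<i> (a - a*)\<close>, \<open>b + b*\<close>, \<open>\<i> (b - b*)\<close> whose squares add up to \<open>8 m\<close>. Attaching to them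
  \<open>4 p\<close> pairwise anti-amicable full matrices over \<open>{1, -1, \<i>, -\<i>}\<close> of order \<open>2 ^ (2 p - 1)\<close> kills
  all mixed terms; replacing quartic units by real \<open>2 \<times> 2\<close> blocks gives the design with \<open>n = 2 p + 3\<close>,
  and larger orders of the anti-amicable family give all larger \<open>n\<close>.

  It remains to write \<open>u\<close> as a sum of at most \<open>lg u / 10 + 5\<close> Golay numbers. The seeds
  \<open>1, 3, 5, 11, 13\<close> and the product \<open>2 m n\<close> supply the Golay numbers \<open>2 ^ a 3 ^ b 5 ^ c 11 ^ d 13 ^ e\<close>
  with \<open>b + c + d + e \<le> a + 1\<close>. Beyond \<open>2 ^ 57\<close> they are so dense that subtracting the largest
  one below \<open>u\<close> repeatedly removes ten binary digits at a time; smaller \<open>u\<close> lose fewer digits per step,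
  which the additive constant absorbs.
\<close>

subsection \<open>Complex Golay numbers\<close>

definition quartic_units :: "complex set" where
  "quartic_units = {1, -1, \<i>, -\<i>}"

lemma quartic_units_mult: "x \<in> quartic_units \<Longrightarrow> y \<in> quartic_units \<Longrightarrow> x * y \<in> quartic_units"
  by (auto simp: quartic_units_def)

lemma quartic_units_uminus: "x \<in> quartic_units \<Longrightarrow> - x \<in> quartic_units"
  by (auto simp: quartic_units_def)

lemma quartic_units_cnj: "x \<in> quartic_units \<Longrightarrow> cnj x \<in> quartic_units"
  by (auto simp: quartic_units_def)

lemma quartic_units_norm: "x \<in> quartic_units \<Longrightarrow> x * cnj x = 1"
  by (auto simp: quartic_units_def)

text \<open>Aperiodic autocorrelation, with positions counted from 0. For \<open>j \<ge> m\<close>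
  truncated subtraction leaves an empty sum, so \<open>golay_pair\<close> may quantify over all
  positive shifts.\<close>

definition acorr :: "nat \<Rightarrow> (nat \<Rightarrow> complex) \<Rightarrow> nat \<Rightarrow> complex" where
  "acorr m a j = (\<Sum>r<m - j. a (r + j) * cnj (a r))"

definition golay_pair :: "nat \<Rightarrow> (nat \<Rightarrow> complex) \<Rightarrow> (nat \<Rightarrow> complex) \<Rightarrow> bool" where
  "golay_pair m a b \<longleftrightarrow> (\<forall>i<m. a i \<in> quartic_units \<and> b i \<in> quartic_units) \<and>
     (\<forall>j\<ge>1. acorr m a j + acorr m b j = 0)"

lemma complex_golay_number_iff:
  "complex_golay_number m \<longleftrightarrow> 0 < m \<and> (\<exists>a b. golay_pair m a b)"
proof
  assume "complex_golay_number m"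
  then obtain a b where m: "0 < m"
    and u: "\<forall>r\<in>{1..m}. a r \<in> quartic_units \<and> b r \<in> quartic_units"
    and z: "\<forall>j\<in>{1..m-1}. (\<Sum>r=1..m-j. a (r+j) * cnj (a r) + b (r+j) * cnj (b r)) = 0"
    unfolding complex_golay_number_def quartic_units_def by blast
  have "golay_pair m (\<lambda>r. a (Suc r)) (\<lambda>r. b (Suc r))"
    unfolding golay_pair_def
  proof (intro conjI allI impI)
    fix j :: nat assume "1 \<le> j"
    show "acorr m (\<lambda>r. a (Suc r)) j + acorr m (\<lambda>r. b (Suc r)) j = 0"
    proof (cases "j < m")
      case True
      then have "j \<in> {1..m-1}" using \<open>1 \<le> j\<close> by auto
      from bspec[OF z this] show ?thesis
        by (simp add: acorr_def sum.atLeast1_atMost_eq sum.distrib)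
    qed (simp add: acorr_def)
  qed (use u in simp_all)
  with m show "0 < m \<and> (\<exists>a b. golay_pair m a b)" by blast
next
  assume "0 < m \<and> (\<exists>a b. golay_pair m a b)"
  then obtain a b where m: "0 < m" and g: "golay_pair m a b" by blast
  have "\<forall>r\<in>{1..m}. a (r - 1) \<in> quartic_units \<and> b (r - 1) \<in> quartic_units"
    using g by (auto simp: golay_pair_def)
  moreover have "\<forall>j\<in>{1..m-1}. (\<Sum>r=1..m-j. a (r + j - 1) * cnj (a (r - 1)) + b (r + j - 1) * cnj (b (r - 1))) = 0"
    using g by (simp add: golay_pair_def acorr_def sum.atLeast1_atMost_eq sum.distrib)
  ultimately show "complex_golay_number m"
    unfolding complex_golay_number_def quartic_units_def
    by (intro conjI m exI[of _ "\<lambda>r. a (r - 1)"] exI[of _ "\<lambda>r. b (r - 1)"])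
qed

section \<open>Generating polynomials on the unit circle and the product of Golay pairs\<close>

definition gen :: "nat \<Rightarrow> (nat \<Rightarrow> complex) \<Rightarrow> complex \<Rightarrow> complex" where
  "gen m a z = (\<Sum>i<m. a i * z ^ i)"

lemma unit_circle_power_cnj:
  assumes "cmod z = 1" "j \<le> m"
  shows "z ^ m * cnj z ^ j = z ^ (m - j)"
proof -
  have "z * cnj z = 1" using assms by (simp add: complex_norm_square[symmetric])
  then have "z ^ j * cnj z ^ j = 1" by (metis power_mult_distrib power_one)
  moreover have "z ^ m = z ^ (m - j) * z ^ j" using assms by (simp flip: power_add)
  ultimately show ?thesis by (simp add: mult.assoc)
qed

text \<open>On the unit circle \<open>cnj z\<close> is the inverse of \<open>z\<close>, so the
  squared modulus is a Laurent polynomial whose coefficients are the autocorrelations. In the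
  induction the new entry adds one term \<open>a m * cnj (a (m - j))\<close> to each shift
  \<open>j\<close>; the top summand \<open>acorr m a m\<close> is an empty sum.\<close>

lemma gen_norm_square:
  assumes z: "cmod z = 1"
  shows "gen m a z * cnj (gen m a z) =
    (\<Sum>i<m. a i * cnj (a i)) + (\<Sum>j=1..m. acorr m a j * z ^ j + cnj (acorr m a j * z ^ j))"
proof (induction m)
  case 0 then show ?case by (simp add: gen_def)
next
  case (Suc m)
  let ?t = "a m * z ^ m"
  have ac: "acorr (Suc m) a j = acorr m a j + a m * cnj (a (m - j))" if "j \<in> {1..m}" for j
    using that by (simp add: acorr_def Suc_diff_le)
  have zz: "z ^ m * cnj z ^ m = 1" using unit_circle_power_cnj[OF z, of m m] by simp
  have cross: "?t * cnj (gen m a z) = (\<Sum>j=1..m. a m * cnj (a (m - j)) * z ^ j)"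
  proof -
    have "?t * cnj (gen m a z) = (\<Sum>i<m. a m * cnj (a i) * z ^ (m - i))"
      unfolding gen_def cnj_sum sum_distrib_left
      by (intro sum.cong) (simp_all add: unit_circle_power_cnj[OF z, symmetric])
    also have "\<dots> = (\<Sum>j=1..m. a m * cnj (a (m - j)) * z ^ j)"
      by (intro sum.reindex_bij_witness[of _ "\<lambda>j. m - j" "\<lambda>i. m - i"]) auto
    finally show ?thesis .
  qed
  have "gen (Suc m) a z * cnj (gen (Suc m) a z) = gen m a z * cnj (gen m a z) + a m * cnj (a m) * (z ^ m * cnj z ^ m)
     + ?t * cnj (gen m a z) + cnj (?t * cnj (gen m a z))"
    by (simp add: gen_def algebra_simps)
  also have "\<dots> = (\<Sum>i<Suc m. a i * cnj (a i)) + (\<Sum>j=1..m. acorr (Suc m) a j * z ^ j + cnj (acorr (Suc m) a j * z ^ j))"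
    unfolding Suc.IH cross zz
    by (simp add: ac sum.distrib algebra_simps)
  finally show ?case by (simp add: acorr_def)
qed

text \<open>Multiplication by \<open>z ^ m\<close> turns the sum into a polynomial of degree at most
  \<open>2 * m\<close>. It vanishes at all \<open>2 * m + 1\<close> roots of unity of that order, so
  all its coefficients are zero.\<close>

lemma trig_poly_zero_imp:
  fixes C :: "nat \<Rightarrow> complex"
  assumes "\<And>z. cmod z = 1 \<Longrightarrow> (\<Sum>j=1..m. C j * z ^ j + cnj (C j * z ^ j)) = 0"
    and "j \<in> {1..m}"
  shows "C j = 0"
proof -
  define p where "p = (\<Sum>j=1..m. monom (C j) (m + j) + monom (cnj (C j)) (m - j))"
  have ev: "poly p z = 0" if "cmod z = 1" for z
  proof -
    have "poly p z = z ^ m * (\<Sum>j=1..m. C j * z ^ j + cnj (C j * z ^ j))"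
      unfolding p_def poly_sum sum_distrib_left
      by (intro sum.cong) (auto simp: poly_monom power_add algebra_simps
          unit_circle_power_cnj[OF that, symmetric])
    then show ?thesis using assms(1)[OF that] by simp
  qed
  have "p = 0"
  proof (rule ccontr)
    assume "p \<noteq> 0"
    have "{z::complex. z ^ Suc (2*m) = 1} \<subseteq> {z. poly p z = 0}"
      using ev power_eq_1_iff[of _ "Suc (2*m)"] by blast
    then have "Suc (2*m) \<le> card {z. poly p z = 0}"
      using card_roots_unity_eq[of "Suc (2*m)"] card_mono[OF poly_roots_finite[OF \<open>p \<noteq> 0\<close>]]
      by (metis zero_less_Suc)
    also have "\<dots> \<le> degree p" by (rule card_poly_roots_bound[OF \<open>p \<noteq> 0\<close>])
    also have "\<dots> \<le> 2 * m" unfolding p_def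
      by (intro degree_sum_le degree_add_le) (auto intro!: order_trans[OF degree_monom_le])
    finally show False by simp
  qed
  \<comment> \<open>As \<open>j\<close> is positive, the exponent \<open>m + j\<close> receives only
    \<open>C j\<close>; the conjugates sit below the exponent \<open>m\<close>.\<close>
  then have "0 = coeff p (m + j)" by simp
  also have "\<dots> = (\<Sum>i=1..m. if i = j then C i else 0)"
    unfolding p_def coeff_sum by (intro sum.cong) (auto simp: coeff_monom)
  also have "\<dots> = C j" using assms(2) by simp
  finally show ?thesis by simp
qed

text \<open>This trades the correlation conditions for one identity between squared moduli, which
  can be handled by algebra with complex numbers.\<close>

lemma golay_pair_iff_gen:
  "golay_pair m a b \<longleftrightarrow> (\<forall>i<m. a i \<in> quartic_units \<and> b i \<in> quartic_units) \<and>
     (\<forall>z. cmod z = 1 \<longrightarrow> gen m a z * cnj (gen m a z) + gen m b z * cnj (gen m b z) = of_nat (2 * m))"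
  (is "_ \<longleftrightarrow> ?U \<and> ?N")
proof (cases ?U)
  case True
  let ?C = "\<lambda>j. acorr m a j + acorr m b j"
  have eq: "gen m a z * cnj (gen m a z) + gen m b z * cnj (gen m b z)
      = of_nat (2 * m) + (\<Sum>j=1..m. ?C j * z ^ j + cnj (?C j * z ^ j))" if "cmod z = 1" for z
  proof -
    have "(\<Sum>i<m. a i * cnj (a i)) = of_nat m" "(\<Sum>i<m. b i * cnj (b i)) = of_nat m"
      using True by (simp_all add: quartic_units_norm)
    then show ?thesis by (simp add: gen_norm_square[OF that] sum.distrib algebra_simps)
  qed
  show ?thesis
  proof
    assume "golay_pair m a b"
    then show "?U \<and> ?N" using eq by (simp add: golay_pair_def)
  next
    assume "?U \<and> ?N"
    then have "(\<Sum>j=1..m. ?C j * z ^ j + cnj (?C j * z ^ j)) = 0" if "cmod z = 1" for z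
      using eq[OF that] that by simp
    then have "?C j = 0" if "j \<in> {1..m}" for j
      by (rule trig_poly_zero_imp[where C = ?C]) (use that in auto)
    moreover have "?C j = 0" if "j > m" for j using that by (simp add: acorr_def)
    ultimately show "golay_pair m a b" using True
      unfolding golay_pair_def by (meson atLeastAtMost_iff not_le)
  qed
qed (auto simp: golay_pair_def)

lemma gen_append:
  "gen (m + n) (\<lambda>i. if i < m then a i else b (i - m)) z = gen m a z + z ^ m * gen n b z"
proof (induction n)
  case (Suc n)
  then show ?case by (simp add: gen_def power_add algebra_simps)
qed (simp add: gen_def)

text \<open>Writing \<open>i = (i div n) * n + i mod n\<close> splits \<open>z ^ i\<close> into a
  power of \<open>z ^ n\<close> and a power of \<open>z\<close>.\<close>

lemma gen_tensor:
  "gen (m * n) (\<lambda>i. a (i div n) * c (i mod n)) z = gen m a (z ^ n) * gen n c z"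
proof (induction m)
  case (Suc m)
  have *: "gen n (\<lambda>i. a ((i + m * n) div n) * c ((i + m * n) mod n)) z = a m * gen n c z"
    unfolding gen_def sum_distrib_left by (intro sum.cong) (auto simp: mult_ac)
  have "(\<lambda>i. if i < m * n then a (i div n) * c (i mod n)
      else a ((i - m * n + m * n) div n) * c ((i - m * n + m * n) mod n)) = (\<lambda>i. a (i div n) * c (i mod n))"
    by auto
  then have "gen (m * n + n) (\<lambda>i. a (i div n) * c (i mod n)) z = gen (m * n) (\<lambda>i. a (i div n) * c (i mod n)) z
     + z ^ (m * n) * gen n (\<lambda>i. a ((i + m * n) div n) * c ((i + m * n) mod n)) z"
    using gen_append[of "m * n" n "\<lambda>i. a (i div n) * c (i mod n)" "\<lambda>i. a ((i + m * n) div n) * c ((i + m * n) mod n)" z]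
    by (simp only:)
  also have "\<dots> = (gen m a (z ^ n) + a m * (z ^ n) ^ m) * gen n c z"
    unfolding * Suc.IH by (simp add: algebra_simps power_mult[symmetric])
  also have "gen m a (z ^ n) + a m * (z ^ n) ^ m = gen (Suc m) a (z ^ n)" by (simp add: gen_def)
  finally show ?case by (simp add: add.commute)
qed (simp add: gen_def)

text \<open>Supplies, up to a unimodular factor, the conjugated values needed in the product
  construction, while the coefficients remain quartic units.\<close>

lemma gen_reverse:
  assumes "cmod z = 1"
  shows "gen n (\<lambda>i. cnj (c (n - 1 - i))) z = z ^ (n - 1) * cnj (gen n c z)"
proof -
  have "gen n (\<lambda>i. cnj (c (n - 1 - i))) z = (\<Sum>i<n. cnj (c i) * z ^ (n - 1 - i))"
    unfolding gen_def by (rule sum.reindex_bij_witness[of _ "\<lambda>j. n - 1 - j" "\<lambda>i. n - 1 - i"]) auto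
  also have "\<dots> = z ^ (n - 1) * cnj (gen n c z)"
    unfolding gen_def cnj_sum sum_distrib_left
    by (intro sum.cong) (auto simp: unit_circle_power_cnj[OF assms, symmetric])
  finally show ?thesis .
qed

lemma gen_uminus: "gen n (\<lambda>i. - a i) z = - gen n a z"
  by (simp add: gen_def sum_negf)

text \<open>With \<open>A\<close>, \<open>B\<close> evaluated at \<open>z ^ n\<close> and
  \<open>C\<close>, \<open>D\<close> at \<open>z\<close>, the new values are
  \<open>A C + x B D\<close> and \<open>y (A cnj D - x B cnj C)\<close> with unimodular
  \<open>x\<close> and \<open>y\<close>. The cross terms cancel, so the squared moduli add up to the
  product of the two given sums, \<open>2 m\<close> times \<open>2 n\<close>.\<close>

lemma golay_pair_mult:
  assumes ab: "golay_pair m a b" and cd: "golay_pair n c d"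
  shows "golay_pair (m * n + m * n)
    (\<lambda>i. if i < m * n then a (i div n) * c (i mod n)
         else b ((i - m * n) div n) * d ((i - m * n) mod n))
    (\<lambda>i. if i < m * n then a (i div n) * cnj (d (n - 1 - i mod n))
         else - (b ((i - m * n) div n) * cnj (c (n - 1 - (i - m * n) mod n))))"
  (is "golay_pair _ ?P ?Q")
  unfolding golay_pair_iff_gen
proof (intro conjI allI impI)
  have u: "a i \<in> quartic_units" "b i \<in> quartic_units" if "i < m" for i
    using ab that by (auto simp: golay_pair_def)
  have u': "c i \<in> quartic_units" "d i \<in> quartic_units" if "i < n" for i
    using cd that by (auto simp: golay_pair_def)
  fix i assume i: "i < m * n + m * n"
  then have n: "n > 0" by (cases n) auto
  have 1: "j div n < m" "j mod n < n" "n - 1 - j mod n < n" if "j < m * n" for j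
    using that n by (auto simp: less_mult_imp_div_less)
  have 2: "i - m * n < m * n" if "\<not> i < m * n" using i that by linarith
  show "?P i \<in> quartic_units"
    using u u' 1[of i] 1[of "i - m * n"] 2 by (simp add: quartic_units_mult)
  show "?Q i \<in> quartic_units"
    using u u' 1[of i] 1[of "i - m * n"] 2
    by (simp add: quartic_units_mult quartic_units_uminus quartic_units_cnj)
next
  fix z :: complex assume z: "cmod z = 1"
  have zn: "cmod (z ^ n) = 1" using z by (simp add: norm_power)
  define A B C D where "A = gen m a (z ^ n)" and "B = gen m b (z ^ n)" and "C = gen n c z" and "D = gen n d z"
  have P: "gen (m * n + m * n) ?P z = A * C + z ^ (m * n) * (B * D)"
    unfolding gen_append[of "m * n" "m * n" "\<lambda>i. a (i div n) * c (i mod n)" "\<lambda>i. b (i div n) * d (i mod n)"]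
      gen_tensor A_def B_def C_def D_def ..
  have Q: "gen (m * n + m * n) ?Q z = A * (z ^ (n - 1) * cnj D) - z ^ (m * n) * (B * (z ^ (n - 1) * cnj C))"
    unfolding gen_append[of "m * n" "m * n" "\<lambda>i. a (i div n) * cnj (d (n - 1 - i mod n))" "\<lambda>i. - (b (i div n) * cnj (c (n - 1 - i mod n)))"]
      gen_uminus gen_tensor[of m n a "\<lambda>i. cnj (d (n - 1 - i))"] gen_tensor[of m n b "\<lambda>i. cnj (c (n - 1 - i))"]
      gen_reverse[OF z] A_def B_def C_def D_def by simp
  have AB: "A * cnj A + B * cnj B = of_nat (2 * m)"
    using ab zn unfolding golay_pair_iff_gen A_def B_def by blast
  have CD: "C * cnj C + D * cnj D = of_nat (2 * n)"
    using cd z unfolding golay_pair_iff_gen C_def D_def by blast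
  define x y where "x = z ^ (m * n)" and "y = z ^ (n - 1)"
  have x: "x * cnj x = 1" and y: "y * cnj y = 1"
    using z by (simp_all add: x_def y_def complex_norm_square[symmetric] norm_power del: complex_cnj_power)
  \<comment> \<open>The cross terms of both squared moduli are collected in the last summand, which
    vanishes because \<open>y\<close> is unimodular.\<close>
  have "gen (m * n + m * n) ?P z * cnj (gen (m * n + m * n) ?P z) + gen (m * n + m * n) ?Q z * cnj (gen (m * n + m * n) ?Q z)
     = (A * cnj A * (C * cnj C) + (x * cnj x) * (B * cnj B * (D * cnj D)))
       + (y * cnj y) * (A * cnj A * (D * cnj D) + (x * cnj x) * (B * cnj B * (C * cnj C)))
       + (1 - y * cnj y) * (A * C * cnj x * cnj B * cnj D + x * B * D * cnj A * cnj C)"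
    unfolding P Q x_def[symmetric] y_def[symmetric] by (simp add: algebra_simps)
  also have "\<dots> = (A * cnj A + B * cnj B) * (C * cnj C + D * cnj D)"
    unfolding x y by (simp add: algebra_simps)
  also have "\<dots> = of_nat (2 * (m * n + m * n))" unfolding AB CD by simp
  finally show "gen (m * n + m * n) ?P z * cnj (gen (m * n + m * n) ?P z)
     + gen (m * n + m * n) ?Q z * cnj (gen (m * n + m * n) ?Q z) = of_nat (2 * (m * n + m * n))" .
qed

lemma complex_golay_number_mult:
  assumes "complex_golay_number m" "complex_golay_number n"
  shows "complex_golay_number (2 * m * n)"
proof -
  obtain a b c d where "0 < m" "0 < n" and *: "golay_pair m a b" "golay_pair n c d"
    using assms unfolding complex_golay_number_iff by blast
  then show ?thesis
    using golay_pair_mult[OF *] unfolding complex_golay_number_iff mult_2 distrib_right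
    by (intro conjI exI) auto
qed

section \<open>Explicit seed pairs\<close>

lemma acorr_nth:
  "length xs = m \<Longrightarrow> acorr m ((!) xs) j = (\<Sum>(x, y)\<leftarrow>zip (drop j xs) xs. x * cnj y)"
  by (simp add: acorr_def sum_list_sum_nth lessThan_atLeast0 add.commute)

text \<open>Reduces a concrete pair to finitely many finite sums that the simplifier evaluates;
  shifts from \<open>m\<close> on vanish by themselves.\<close>

lemma golay_pair_nthI:
  assumes "length xs = m" "length ys = m" "set xs \<subseteq> quartic_units" "set ys \<subseteq> quartic_units"
    and "list_all (\<lambda>j. (\<Sum>(x, y)\<leftarrow>zip (drop j xs) xs. x * cnj y) + (\<Sum>(x, y)\<leftarrow>zip (drop j ys) ys. x * cnj y) = 0) [1..<m]"
  shows "golay_pair m ((!) xs) ((!) ys)"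
  unfolding golay_pair_def
proof (intro conjI allI impI)
  fix j :: nat assume "1 \<le> j"
  then show "acorr m ((!) xs) j + acorr m ((!) ys) j = 0"
    using assms by (cases "j < m") (auto simp: list_all_iff acorr_nth)
qed (use assms in auto)

lemma complex_golay_number_1: "complex_golay_number 1"
  using golay_pair_nthI[of "[1]" 1 "[1]"]
  by (auto simp: complex_golay_number_iff quartic_units_def)

lemma complex_golay_number_3: "complex_golay_number 3"
proof -
  have "golay_pair 3 ((!) [1, 1, -1]) ((!) [1, \<i>, 1])"
    by (rule golay_pair_nthI) (simp_all add: quartic_units_def upt_rec)
  then show ?thesis by (auto simp: complex_golay_number_iff)
qed

lemma complex_golay_number_5: "complex_golay_number 5"
proof -
  have "golay_pair 5 ((!) [1, 1, 1, \<i>, -\<i>]) ((!) [1, \<i>, -\<i>, -1, \<i>])"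
    by (rule golay_pair_nthI) (simp_all add: quartic_units_def upt_rec)
  then show ?thesis by (auto simp: complex_golay_number_iff)
qed

lemma complex_golay_number_11: "complex_golay_number 11"
proof -
  have "golay_pair 11 ((!) [1, \<i>, -1, 1, -1, \<i>, -\<i>, -1, \<i>, \<i>, 1]) ((!) [1, 1, -\<i>, -\<i>, -\<i>, 1, 1, \<i>, -1, 1, -1])"
    by (rule golay_pair_nthI) (simp_all add: quartic_units_def upt_rec)
  then show ?thesis by (auto simp: complex_golay_number_iff)
qed

lemma complex_golay_number_13: "complex_golay_number 13"
proof -
  have "golay_pair 13 ((!) [1, 1, 1, \<i>, -1, 1, 1, -\<i>, 1, -1, 1, -\<i>, \<i>]) ((!) [1, \<i>, -1, -1, -1, \<i>, -1, 1, 1, -\<i>, -1, 1, -\<i>])"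
    by (rule golay_pair_nthI) (simp_all add: quartic_units_def upt_rec)
  then show ?thesis by (auto simp: complex_golay_number_iff)
qed

subsection \<open>Short sums of complex Golay numbers\<close>

text \<open>Each use of the product \<open>2 * m * n\<close> with a seed as \<open>m\<close> brings
  one factor 2 and at most one odd seed factor. A single seed is available already at
  \<open>a = 0\<close>, hence the \<open>+ 1\<close>.\<close>

lemma complex_golay_number_smooth:
  assumes "b + c + d + e \<le> a + 1"
  shows "complex_golay_number (2 ^ a * 3 ^ b * 5 ^ c * 11 ^ d * 13 ^ e)"
  using assms
proof (induction a arbitrary: b c d e)
  case 0
  then have "b = 0 \<and> c = 0 \<and> d = 0 \<and> e = 0 \<or> b = 1 \<and> c = 0 \<and> d = 0 \<and> e = 0 \<or> b = 0 \<and> c = 1 \<and> d = 0 \<and> e = 0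
    \<or> b = 0 \<and> c = 0 \<and> d = 1 \<and> e = 0 \<or> b = 0 \<and> c = 0 \<and> d = 0 \<and> e = 1"
    by (cases b; cases c; cases d; cases e) simp_all
  then show ?case
    using complex_golay_number_1 complex_golay_number_3 complex_golay_number_5
      complex_golay_number_11 complex_golay_number_13 by (elim disjE) simp_all
next
  case (Suc a)
  note mult = complex_golay_number_mult
  have "x = 0 \<or> (\<exists>y. x = Suc y)" for x :: nat by (cases x) auto
  from this[of b] this[of c] this[of d] this[of e]
  consider "b = 0 \<and> c = 0 \<and> d = 0 \<and> e = 0" | b' where "b = Suc b'" | c' where "c = Suc c'" | d' where "d = Suc d'" | e' where "e = Suc e'"
    by blast
  then show ?case
  proof cases
    case 1
    then show ?thesis using mult[OF complex_golay_number_1 Suc.IH[of b c d e]] by (simp add: mult_ac)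
  next
    case 2
    then show ?thesis using mult[OF complex_golay_number_3 Suc.IH[of b' c d e]] Suc.prems by (simp add: mult_ac)
  next
    case 3
    then show ?thesis using mult[OF complex_golay_number_5 Suc.IH[of b c' d e]] Suc.prems by (simp add: mult_ac)
  next
    case 4
    then show ?thesis using mult[OF complex_golay_number_11 Suc.IH[of b c d' e]] Suc.prems by (simp add: mult_ac)
  next
    case 5
    then show ?thesis using mult[OF complex_golay_number_13 Suc.IH[of b c d e']] Suc.prems by (simp add: mult_ac)
  qed
qed

text \<open>
  Each tuple of exponents encodes a Golay number, and consecutive ones differ by at most \<open>G\<close>, from
  \<open>p\<close> up to \<open>E\<close>. As doubling preserves Golay numbers, a chain through one octave serves all higher ones.
\<close>

fun golay_chain :: "nat \<Rightarrow> nat \<Rightarrow> nat \<Rightarrow> (nat \<times> nat \<times> nat \<times> nat \<times> nat) list \<Rightarrow> bool" where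
  "golay_chain G E p [] \<longleftrightarrow> E \<le> p + G"
| "golay_chain G E p ((a, b, c, d, e) # xs) \<longleftrightarrow> b + c + d + e \<le> a + 1 \<and>
     (let g = 2 ^ a * 3 ^ b * 5 ^ c * 11 ^ d * 13 ^ e in g \<le> p + G \<and> golay_chain G E g xs)"

text \<open>Walk along the chain as long as \<open>s * g \<le> u\<close>; the first scaled element
  beyond \<open>u\<close> is at most \<open>s * G\<close> above the one before it, which is the
  \<open>g\<close> sought. The factor \<open>s\<close> will be a power of two, moving one chain to
  higher octaves.\<close>

lemma golay_chain_covers:
  assumes "golay_chain G E p xs" "complex_golay_number p" "s * p \<le> u" "u \<le> s * E"
  shows "\<exists>g. complex_golay_number g \<and> s * g \<le> u \<and> u \<le> s * g + s * G"
  using assms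
proof (induction G E p xs rule: golay_chain.induct)
  case (1 G E p)
  then have "E \<le> p + G" by simp
  from mult_le_mono2[OF this, of s] have "u \<le> s * p + s * G"
    using 1(4) unfolding distrib_left by (rule order_trans[rotated])
  with 1(2,3) show ?case by blast
next
  case (2 G E p a b c d e xs)
  define g where "g = (2::nat) ^ a * 3 ^ b * 5 ^ c * 11 ^ d * 13 ^ e"
  have g: "complex_golay_number g" "g \<le> p + G" "golay_chain G E g xs"
    using 2(2) complex_golay_number_smooth[of b c d e a] by (simp_all add: g_def Let_def)
  show ?case
  proof (cases "s * g \<le> u")
    case True
    from 2(1)[OF g_def g(3,1) True 2(5)] show ?thesis .
  next
    case False
    have "s * g \<le> s * p + s * G" using mult_le_mono2[OF g(2), of s] by (simp add: distrib_left)
    with False have "u \<le> s * p + s * G" by linarith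
    with 2(3,4) show ?thesis by blast
  qed
qed

text \<open>The parameter \<open>i\<close> counts the binary digits gained by subtracting one Golay
  number, and \<open>n0\<close> is the octave from which this gain is guaranteed.\<close>

definition golay_net :: "nat \<Rightarrow> nat \<Rightarrow> bool" where
  "golay_net i n0 \<longleftrightarrow> (\<forall>n\<ge>n0. \<forall>u. 2 ^ n \<le> u \<and> u \<le> 2 ^ Suc n \<longrightarrow>
     (\<exists>g. complex_golay_number g \<and> g \<le> u \<and> u - g \<le> 2 ^ (n - i)))"

lemma complex_golay_number_power2: "complex_golay_number (2 ^ a)"
  using complex_golay_number_smooth[of 0 0 0 0 a] by simp

lemma complex_golay_number_scale: "complex_golay_number g \<Longrightarrow> complex_golay_number (2 ^ t * g)"
proof (induction t)
  case (Suc t)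
  then show ?case using complex_golay_number_mult[OF complex_golay_number_1, of "2 ^ t * g"] by (simp add: mult.assoc)
qed simp

text \<open>Scaling by \<open>2 ^ (n - n0)\<close> maps octave \<open>n0\<close> onto octave
  \<open>n\<close> and the gap \<open>2 ^ (n0 - i)\<close> onto \<open>2 ^ (n - i)\<close>; the
  condition \<open>i \<le> n0\<close> keeps the subtraction of exponents exact.\<close>

lemma golay_netI:
  assumes "golay_chain (2 ^ (n0 - i)) (2 ^ Suc n0) (2 ^ n0) xs" "i \<le> n0"
  shows "golay_net i n0"
  unfolding golay_net_def
proof (intro allI impI)
  fix n u :: nat assume n: "n0 \<le> n" and u: "2 ^ n \<le> u \<and> u \<le> 2 ^ Suc n"
  define t where "t = n - n0"
  have e: "2 ^ t * 2 ^ n0 = (2::nat) ^ n" "2 ^ t * 2 ^ Suc n0 = (2::nat) ^ Suc n" "2 ^ t * 2 ^ (n0 - i) = (2::nat) ^ (n - i)"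
    using n assms(2) by (simp_all add: t_def power_add[symmetric] del: power_Suc)
  obtain g where "complex_golay_number g" "2 ^ t * g \<le> u" "u \<le> 2 ^ t * g + 2 ^ (n - i)"
    using golay_chain_covers[OF assms(1) complex_golay_number_power2, of "2 ^ t" u] u unfolding e by auto
  then show "\<exists>g. complex_golay_number g \<and> g \<le> u \<and> u - g \<le> 2 ^ (n - i)"
    using complex_golay_number_scale[of g t] by (intro exI[of _ "2 ^ t * g"]) simp
qed

text \<open>The lists in this and the next six lemmas are certificates: the simplifier checks the
  exponent condition and the gap of every entry. Doubling embeds the products of one octave into the
  next, so octaves only become richer, and finer gaps are sought higher up.\<close>

lemma golay_net_3: "golay_net 3 8"
proof (rule golay_netI)
  show "golay_chain (2 ^ (8 - 3)) (2 ^ Suc 8) (2 ^ 8)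
    [(5,2,0,0,0), (6,0,1,0,0), (5,0,0,1,0), (7,1,0,0,0), (5,0,0,0,1), (3,0,1,1,0), (2,2,0,0,1),
     (2,0,3,0,0)]"
    by simp
qed simp

lemma golay_net_4: "golay_net 4 12"
proof (rule golay_netI)
  show "golay_chain (2 ^ (12 - 4)) (2 ^ Suc 12) (2 ^ 12)
    [(5,3,1,0,0), (5,0,0,1,1), (6,1,2,0,0), (3,0,4,0,0), (4,0,2,0,1), (5,0,0,0,2), (9,0,0,1,0),
     (4,1,0,2,0), (4,1,3,0,0), (5,1,1,0,1), (4,4,1,0,0), (9,0,0,0,1), (8,3,0,0,0), (7,0,1,1,0),
     (5,2,2,0,0), (2,0,0,1,2), (9,1,1,0,0), (4,2,1,1,0), (4,1,0,0,2)]"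
    by simp
qed simp

lemma golay_net_5: "golay_net 5 16"
proof (rule golay_netI)
  show "golay_chain (2 ^ (16 - 5)) (2 ^ Suc 16) (2 ^ 16)
    [(11,1,0,1,0), (9,3,1,0,0), (8,0,2,1,0), (6,2,3,0,0), (13,2,0,0,0), (4,1,0,2,1), (7,0,1,2,0),
     (5,2,2,1,0), (5,1,1,0,2), (10,4,0,0,0), (9,1,1,1,0), (9,0,0,0,2), (6,0,3,1,0), (8,3,0,0,1),
     (7,0,1,1,1), (7,6,0,0,0), (6,3,1,1,0), (5,0,2,2,0), (15,1,0,0,0), (5,0,5,0,0), (10,2,0,1,0),
     (4,2,1,1,1), (5,3,0,2,0), (13,0,0,0,1), (7,0,1,0,2), (4,0,4,1,0), (12,3,0,0,0), (11,0,1,1,0),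
     (5,0,2,1,1), (6,1,1,2,0), (3,0,0,4,0), (6,0,0,1,2), (6,1,4,0,0), (4,2,1,0,2), (5,3,0,1,1),
     (7,1,2,0,1), (8,2,1,1,0), (10,0,3,0,0), (4,0,4,0,1)]"
    by simp
qed simp

lemma golay_net_6: "golay_net 6 23"
proof (rule golay_netI)
  show "golay_chain (2 ^ (23 - 6)) (2 ^ Suc 23) (2 ^ 23)
    [(17,0,1,0,1), (18,1,0,1,0), (7,4,1,0,2), (9,0,0,3,1), (10,3,2,0,1), (7,2,1,2,1), (9,0,3,1,1),
     (7,1,0,1,3), (16,0,0,1,1), (20,2,0,0,0), (10,0,1,1,2), (6,4,0,1,2), (8,2,2,0,2), (17,1,2,0,0),
     (13,5,1,0,0), (9,9,0,0,0), (12,2,2,1,0), (8,6,1,1,0), (12,1,1,0,2), (8,5,0,0,2), (17,4,0,0,0),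
     (7,2,1,1,2), (9,0,3,0,2), (13,0,0,3,0), (6,0,6,1,0), (16,0,0,0,2), (10,7,1,0,0), (7,6,0,2,0),
     (11,1,0,1,2), (20,0,0,1,0), (8,1,3,2,0), (14,0,1,1,1), (18,2,1,0,0), (8,0,2,1,2), (8,1,6,0,0),
     (8,6,1,0,1), (6,0,0,4,1), (15,1,3,0,0), (12,0,2,2,0), (9,1,4,0,1), (6,0,3,2,1), (10,2,3,1,0),
     (12,0,5,0,0), (13,0,0,2,1), (6,0,6,0,1), (19,0,2,0,0), (7,1,5,1,0), (13,0,3,0,1), (11,8,0,0,0),
     (7,0,4,0,2), (20,0,0,0,1), (8,1,3,1,1), (14,0,1,0,2), (9,2,2,2,0), (8,0,2,0,3), (19,3,0,0,0),
     (9,1,1,1,2), (9,2,5,0,0), (6,1,4,2,0), (12,0,2,1,1), (16,2,2,0,0), (6,0,3,1,2), (10,0,0,4,0),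
     (7,1,2,2,1), (13,0,0,1,2), (13,1,4,0,0), (10,0,3,2,0), (7,1,5,0,1), (20,1,1,0,0), (17,0,0,2,0),
     (14,1,2,0,1), (6,3,1,1,2), (10,5,1,0,1), (8,1,3,0,2), (7,4,0,2,1), (11,6,0,1,0), (9,2,2,1,1),
     (13,4,2,0,0), (11,0,4,0,1), (10,3,1,2,0)]"
    by simp
qed simp

lemma golay_net_7: "golay_net 7 31"
proof (rule golay_netI)
  show "golay_chain (2 ^ (31 - 7)) (2 ^ Suc 31) (2 ^ 31)
    [(12,0,5,0,2), (13,0,0,2,3), (10,1,2,0,4), (21,4,0,0,1), (9,5,3,1,1), (13,7,3,0,0), (16,0,5,1,0),
     (17,0,0,3,1), (14,1,2,1,2), (18,3,2,0,1), (10,5,1,1,2), (14,7,1,0,1), (17,0,3,1,1), (21,2,3,0,0),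
     (9,3,6,1,0), (19,3,0,0,2), (14,5,1,2,0), (8,0,7,2,0), (18,0,1,1,2), (13,2,2,3,0), (14,4,0,1,2),
     (15,0,4,2,0), (7,0,0,7,0), (11,4,3,2,0), (12,6,1,0,2), (22,0,1,2,0), (7,1,2,2,3), (8,3,0,0,5),
     (17,9,0,0,0), (13,1,4,0,2), (12,4,1,2,1), (22,0,4,0,0), (14,2,3,1,1), (13,5,0,3,0), (16,0,5,0,1),
     (8,2,4,1,2), (16,5,0,0,2), (10,0,6,0,2), (9,3,3,2,1), (10,5,1,0,3), (11,1,5,1,1), (19,4,1,0,1),
     (11,6,0,1,2), (21,0,0,3,0), (9,3,6,0,1), (14,0,6,1,0), (22,3,2,0,0), (14,5,1,1,1), (8,0,7,1,1),
     (16,3,3,0,1), (15,6,0,2,0), (9,1,6,2,0), (10,3,4,0,2), (9,6,1,2,1), (19,2,4,0,0), (11,4,3,1,1),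
     (10,7,0,3,0), (13,2,5,0,1), (12,5,2,2,0), (11,10,2,0,0), (11,3,2,0,3), (16,0,2,1,2), (8,2,1,2,3),
     (16,1,6,0,0), (12,4,1,1,2), (13,0,5,2,0), (21,3,1,1,0), (10,1,7,0,1), (8,1,0,1,5), (17,7,0,1,0),
     (11,2,6,1,0), (20,0,2,2,0), (19,5,2,0,0), (13,0,8,0,0), (9,1,0,5,1), (15,9,1,0,0), (15,2,1,0,3),
     (12,8,0,2,0), (12,1,0,2,3), (11,6,0,0,3), (12,2,4,1,1), (21,0,0,2,1), (20,5,0,0,1), (14,0,6,0,1),
     (10,3,1,1,3), (27,0,2,0,0), (10,4,5,0,1), (8,0,7,0,2), (11,4,0,2,2), (21,0,3,0,1), (10,2,0,0,5),
     (9,1,6,1,1), (19,8,0,0,0), (13,3,6,0,0), (9,6,1,1,2), (10,2,5,2,0), (13,8,1,0,1), (13,1,1,0,4),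
     (10,7,0,2,1), (20,3,3,0,0), (9,5,0,0,4), (10,1,4,1,2), (16,7,2,0,0), (16,0,2,0,3), (13,6,1,2,0),
     (11,0,0,6,0), (12,4,1,0,3), (13,0,5,1,1), (9,3,0,2,3), (26,0,1,1,0), (8,1,0,0,6), (14,1,4,2,0),
     (13,6,4,0,0), (20,0,2,1,1), (10,5,3,2,0), (8,1,5,2,1), (11,7,1,0,2), (9,1,0,4,2), (14,0,3,1,2),
     (20,6,1,0,0), (18,0,0,4,0), (10,4,2,1,2), (16,10,0,0,0), (14,6,2,0,1), (12,0,1,4,1), (11,5,1,2,1),
     (9,1,3,2,2), (15,7,1,1,0), (13,1,0,5,0), (12,6,0,3,0), (11,11,0,1,0), (11,0,9,0,0), (6,0,0,0,7),
     (13,9,2,0,0), (11,5,4,0,1), (25,0,0,2,0), (24,5,0,0,0), (22,1,2,0,1), (12,6,3,1,0), (10,2,5,1,1),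
     (19,0,1,2,1), (9,5,2,3,0), (16,1,3,0,2), (10,7,0,1,2), (8,3,2,1,3), (14,9,0,0,1), (12,5,2,0,2),
     (10,1,4,0,3), (13,1,6,1,0), (9,4,1,2,2), (7,0,3,2,3), (13,6,1,1,1), (11,2,3,1,2)]"
    by simp
qed simp

lemma golay_net_8: "golay_net 8 40"
proof (rule golay_netI)
  show "golay_chain (2 ^ (40 - 8)) (2 ^ Suc 40) (2 ^ 40)
    [(11,4,2,2,3), (17,10,0,1,1), (15,6,2,1,2), (13,2,4,1,3), (34,0,1,0,1), (15,7,6,0,0), (13,3,8,0,1),
     (16,7,1,2,1), (14,3,3,2,2), (28,0,2,0,2), (15,5,1,0,4), (13,1,3,0,5), (17,8,0,3,0), (24,4,1,0,2),
     (16,2,9,0,0), (19,6,2,2,0), (10,1,6,1,3), (20,8,0,0,2), (18,4,2,0,3), (16,0,4,0,4), (29,7,0,0,0),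
     (11,2,5,2,2), (32,0,2,1,0), (12,4,3,0,4), (10,0,5,0,5), (14,7,2,3,0), (21,3,3,0,2), (13,1,11,0,0),
     (13,5,2,1,3), (11,1,4,1,4), (15,10,4,0,0), (13,6,6,0,1), (11,2,8,0,2), (20,0,4,1,2), (14,6,1,2,2),
     (12,2,3,2,3), (20,1,8,0,0), (13,4,1,0,5), (11,0,3,0,6), (17,0,7,2,0), (20,6,3,0,1), (18,2,5,0,2),
     (12,8,2,1,2), (9,1,0,0,8), (15,1,4,2,2), (18,7,0,0,3), (16,3,2,0,4), (15,2,8,1,0), (24,0,4,2,0),
     (11,5,3,2,2), (25,2,2,0,2), (17,0,10,0,0), (10,3,3,0,5), (15,0,3,1,4), (19,9,3,0,0), (17,5,5,0,1),
     (15,1,7,0,2), (16,8,2,2,0), (13,1,0,1,6), (12,0,6,2,2), (15,6,2,0,3), (13,2,4,0,4), (12,1,10,1,0),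
     (12,5,1,2,3), (20,4,6,0,0), (18,0,8,0,1), (11,3,1,0,6), (16,0,1,1,5), (31,0,4,0,0), (18,5,3,0,2),
     (16,1,5,0,3), (17,8,0,2,1), (15,4,2,2,2), (13,0,4,2,3), (16,6,0,0,4), (14,2,2,0,5), (13,1,8,1,1),
     (23,8,2,0,0), (21,4,4,0,1), (19,0,6,0,2), (13,6,3,1,2), (11,2,5,1,3), (32,0,2,0,1), (13,7,7,0,0),
     (17,1,3,0,4), (16,0,9,1,0), (16,4,0,2,3), (21,1,0,3,2), (18,9,2,1,0), (13,5,2,0,4), (12,4,8,1,0),
     (30,0,0,3,0), (20,7,4,0,0), (24,1,0,0,4), (23,0,6,1,0), (9,2,1,0,7), (15,2,5,2,1), (18,8,1,0,2),
     (23,5,1,1,1), (12,1,4,4,1), (15,7,0,2,2), (20,4,0,3,1), (25,1,0,4,0), (15,8,4,1,0), (10,2,1,4,3),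
     (23,11,0,0,0), (11,0,8,1,2), (21,7,2,0,1), (26,4,2,1,0), (13,9,1,1,2), (18,6,1,2,1), (23,3,1,3,0),
     (12,1,7,2,1), (15,7,3,0,2), (10,1,0,3,5), (14,10,0,2,1), (18,0,5,1,2), (12,6,2,2,2), (24,6,3,0,0),
     (10,0,1,6,2), (16,8,2,1,1), (11,4,2,0,5), (23,2,0,2,2), (20,10,2,0,0), (22,7,0,0,2), (18,4,1,4,0),
     (16,2,6,0,2), (17,9,1,2,0), (12,5,1,1,4), (15,3,0,6,0), (13,1,5,2,2), (16,7,1,0,3), (12,4,2,4,1),
     (16,0,1,0,6), (13,2,9,1,0), (13,6,0,2,3), (25,6,1,0,1), (21,5,5,0,0), (23,0,0,4,1), (15,0,11,0,0),
     (15,4,2,1,3), (27,2,0,3,0), (16,0,6,2,1), (19,6,2,0,2), (15,5,6,0,1), (17,0,1,4,2), (14,8,3,2,0),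
     (16,5,1,2,2), (11,1,1,1,6), (15,10,1,0,2), (22,0,8,0,0), (15,3,1,0,5), (18,1,0,5,1), (23,0,3,2,1),
     (17,6,0,3,1), (22,5,3,0,1), (16,11,0,1,1), (16,0,9,0,1), (16,4,0,1,4), (20,13,0,0,0), (17,0,4,2,2),
     (20,6,0,0,3), (16,5,4,0,2), (9,0,0,7,2), (17,1,8,1,0), (10,4,1,1,5), (13,2,0,6,1), (11,0,5,2,3),
     (12,7,0,4,1), (17,6,3,1,1), (12,2,3,0,5), (15,0,2,5,1), (36,0,2,0,0), (14,5,2,3,1), (19,4,5,0,1),
     (13,10,2,1,1), (15,7,0,1,3), (10,3,0,0,7), (13,3,2,1,4), (16,1,1,6,0), (30,0,3,0,1), (24,6,0,1,1),
     (13,4,6,0,2), (13,0,0,8,0), (14,0,10,1,0), (14,4,1,2,3), (9,0,1,1,7), (13,9,1,0,3), (16,9,3,1,0),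
     (11,5,3,0,4), (13,2,1,0,6), (16,2,3,1,3), (12,1,7,1,2), (22,8,1,0,1), (18,7,5,0,0), (20,4,3,0,2),
     (14,10,0,1,2), (21,0,7,1,0), (15,6,4,2,0), (10,2,4,1,4), (13,2,6,2,1), (23,9,0,1,0), (18,5,0,0,4),
     (14,4,4,0,3), (16,1,2,0,5), (12,0,6,0,4), (13,7,1,2,2), (25,7,2,0,0), (11,3,3,2,3), (23,3,4,0,1),
     (19,2,8,0,0), (28,0,4,1,0), (12,5,1,0,5), (15,5,3,1,2), (10,1,3,0,6), (20,0,0,6,0), (14,8,0,3,1),
     (19,7,3,0,1), (15,6,7,0,0), (17,3,5,0,2), (18,10,0,2,0), (13,6,0,1,4), (16,6,2,2,1), (11,2,2,1,5),
     (14,2,4,2,2), (26,2,5,0,0), (35,0,1,1,0), (13,7,4,0,2), (15,4,2,0,4), (11,3,6,0,3), (13,0,4,0,5),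
     (16,0,6,1,2), (17,7,1,3,0), (22,6,4,0,0), (24,3,2,0,2), (20,2,6,0,1), (16,1,10,0,0), (14,6,0,5,0),
     (11,1,1,0,7), (13,11,0,3,0), (18,10,3,0,0), (20,7,1,0,2), (16,6,5,0,1), (18,3,3,0,3), (14,2,7,0,2),
     (15,9,2,2,0), (17,6,0,2,2), (12,2,0,1,6), (15,2,2,2,3), (11,1,6,2,2), (12,8,1,4,0), (16,4,0,0,5),
     (12,3,4,0,4), (14,0,2,0,6), (25,10,0,0,0), (11,6,1,2,3), (23,6,2,0,1), (19,5,6,0,0), (21,2,4,0,2),
     (17,1,8,0,1), (13,0,12,0,0), (20,5,1,2,1), (15,1,1,1,5), (11,0,5,1,4), (14,0,7,2,1), (15,9,5,0,0),
     (17,6,3,0,2), (13,5,7,0,1), (15,2,5,0,3), (11,1,9,0,2), (27,0,3,2,0), (11,5,0,1,5), (14,5,2,2,2),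
     (9,1,2,1,6), (12,1,4,2,3), (24,1,5,0,1), (20,0,9,0,0), (18,7,2,1,1), (13,3,2,0,5), (15,0,0,0,7),
     (12,2,8,1,1), (21,0,4,2,1), (22,9,2,0,0), (24,6,0,0,2), (20,5,4,0,1), (16,4,8,0,0), (18,1,6,0,2),
     (14,0,10,0,1), (12,5,0,5,1), (17,4,3,2,1), (12,0,3,1,5), (15,0,5,2,2), (27,0,6,0,0), (18,6,1,0,3),
     (14,5,5,0,2), (16,2,3,0,4), (12,1,7,0,3), (15,1,9,1,0), (13,8,2,2,1), (15,5,0,2,3), (10,1,0,1,7),
     (23,4,5,0,0), (25,1,3,0,2), (21,0,7,0,1), (12,6,2,0,4), (14,3,0,0,6), (10,2,4,0,5), (13,2,6,1,2),
     (22,0,2,2,2), (34,0,3,0,0), (19,8,4,0,0), (21,5,2,0,2), (17,4,6,0,1), (13,3,10,0,0), (15,0,8,0,2),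
     (13,7,1,1,3), (16,7,3,2,0), (11,3,3,1,4), (13,0,1,1,6), (16,0,3,2,3), (28,0,4,0,1), (13,8,5,0,1),
     (15,5,3,0,3), (17,2,1,0,5), (13,1,5,0,4), (16,1,7,1,1)]"
    by simp
qed simp

lemma golay_net_9: "golay_net 9 57"
proof (rule golay_netI)
  show "golay_chain (2 ^ (57 - 9)) (2 ^ Suc 57) (2 ^ 57)
    [(18,3,2,0,8), (14,2,6,0,7), (17,2,8,1,4), (25,10,1,4,0), (29,6,0,0,5), (19,7,10,0,1),
     (17,12,0,5,1), (21,0,2,8,1), (51,0,1,0,1), (19,4,1,1,7), (14,0,1,0,11), (17,0,3,1,8), (30,3,8,0,1),
     (20,19,0,2,0), (24,7,2,5,0), (28,3,1,1,5), (17,1,7,0,6), (16,9,1,6,1), (20,5,0,2,6), (15,1,0,1,10),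
     (22,6,11,0,0), (20,11,1,5,0), (24,7,0,1,5), (19,3,0,0,9), (15,2,4,0,8), (18,2,6,1,5), (17,10,0,7,0),
     (22,9,3,4,0), (27,8,6,1,0), (22,4,6,0,4), (18,3,10,0,3), (20,0,8,0,5), (19,8,2,6,0), (24,7,5,3,0),
     (18,0,1,1,9), (15,2,9,2,3), (27,2,10,0,1), (16,7,1,8,0), (46,7,0,0,0), (25,2,3,1,5), (21,1,7,1,4),
     (17,0,11,1,3), (23,17,0,1,1), (27,5,2,4,1), (32,4,5,1,1), (27,0,5,0,5), (17,1,15,0,1), (31,7,2,3,0),
     (36,6,5,0,0), (22,2,6,2,3), (18,1,10,2,2), (30,1,11,0,0), (21,7,6,0,3), (17,6,10,0,2), (19,3,8,0,4),
     (21,0,6,0,6), (20,8,0,6,1), (25,7,3,3,1), (30,6,6,0,1), (26,5,10,0,0), (28,2,8,0,2), (24,1,12,0,1),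
     (20,0,16,0,0), (24,3,0,5,3), (29,2,3,2,3), (25,1,7,2,2), (21,0,11,2,1), (22,9,9,0,0), (13,0,0,1,11),
     (20,5,11,0,1), (22,2,9,0,3), (18,1,13,0,2), (23,7,1,6,0), (18,3,1,5,4), (39,3,1,0,3), (19,1,8,2,3),
     (15,0,12,2,2), (20,6,0,8,0), (18,6,8,0,3), (20,3,6,0,5), (16,2,10,0,4), (19,2,12,1,1), (28,0,8,2,1),
     (29,9,6,0,0), (14,2,3,1,8), (27,5,8,0,1), (23,4,12,0,0), (25,1,10,0,2), (21,0,14,0,1), (18,4,3,0,7),
     (20,1,1,0,9), (16,0,5,0,8), (19,0,7,1,5), (22,0,9,2,2), (34,0,10,0,0), (19,8,11,0,0), (21,5,9,0,2),
     (17,4,13,0,1), (19,1,11,0,3), (25,18,0,0,1), (20,6,3,6,0), (31,3,0,3,3), (27,2,4,3,2), (23,1,8,3,1),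
     (19,0,12,3,0), (19,6,6,0,4), (21,3,4,0,6), (17,2,8,0,5), (20,2,10,1,2), (16,1,14,1,1), (41,0,7,0,0),
     (15,2,1,1,9), (28,5,6,0,2), (24,4,10,0,1), (20,3,14,0,0), (22,0,12,0,2), (28,17,1,0,0),
     (13,2,1,8,3), (25,2,2,6,1), (21,1,6,6,0), (24,9,5,0,2), (20,8,9,0,1), (22,5,7,0,3), (18,4,11,0,2),
     (24,21,0,0,0), (16,0,13,0,3), (22,17,2,0,1), (24,14,0,0,3), (35,3,0,4,1), (22,10,2,0,4),
     (24,7,0,0,6), (21,9,8,1,0), (23,6,6,1,2), (25,3,4,1,4), (27,0,2,1,6), (24,2,10,2,0), (42,0,5,0,1),
     (27,8,6,0,1), (29,5,4,0,3), (15,1,5,2,6), (27,1,6,0,4), (30,1,8,1,1), (55,0,1,0,0), (17,6,7,1,3),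
     (19,3,5,1,5), (21,0,3,1,7), (18,2,11,2,1), (36,0,6,0,2), (21,8,7,0,2), (23,5,5,0,4), (25,2,3,0,6),
     (22,4,11,1,0), (24,1,9,1,2), (49,0,2,0,1), (17,4,2,1,7), (19,1,0,1,9), (16,3,8,2,3), (28,3,9,0,1),
     (30,0,7,0,3), (33,0,9,1,0), (17,5,6,0,5), (19,2,4,0,7), (22,2,6,1,4), (25,2,8,2,1), (43,0,3,0,2),
     (28,8,4,0,2), (30,5,2,0,4), (32,2,0,0,6), (29,4,8,1,0), (31,1,6,1,2), (18,0,11,4,0), (17,3,1,0,9),
     (20,3,3,1,6), (17,5,11,2,0), (19,2,9,2,2), (37,0,4,0,3), (40,0,6,1,0), (18,7,9,0,2), (20,4,7,0,4),
     (22,1,5,0,6), (25,1,7,1,3), (28,1,9,2,0), (18,4,0,1,8), (31,7,5,0,1), (23,1,0,2,7), (36,4,5,1,0),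
     (29,1,4,4,1), (22,6,0,0,7), (25,6,2,1,4), (28,6,4,2,1), (21,3,3,5,2), (14,0,2,8,3), (17,8,1,2,5),
     (20,8,3,3,2), (20,6,0,7,1), (25,7,6,0,2), (17,1,1,2,8), (30,4,6,1,1), (23,1,5,4,2), (16,6,1,0,8),
     (19,6,3,1,5), (22,6,5,2,2), (40,4,0,0,3), (17,0,2,5,5), (45,1,0,1,2), (23,8,3,0,4), (26,8,5,1,1),
     (19,5,4,4,2), (28,3,0,5,2), (22,11,0,2,3), (24,0,1,9,0), (18,8,1,6,1), (25,0,11,2,0), (15,3,2,1,8),
     (28,6,7,0,1), (21,3,6,3,2), (39,1,1,1,3), (17,8,4,0,5), (20,8,6,1,2), (29,6,2,2,2), (22,3,1,5,3),
     (25,3,3,6,0), (18,0,2,9,1), (19,9,0,7,0), (19,0,12,2,1), (20,9,10,0,0), (28,4,2,0,5), (31,4,4,1,2),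
     (24,1,3,4,3), (27,1,5,5,0), (21,9,5,2,1), (30,7,1,3,1), (23,4,0,6,2), (17,12,0,3,3), (20,12,2,4,0),
     (17,1,9,2,3), (20,1,11,3,0), (20,7,5,0,4), (23,7,7,1,1), (16,4,6,4,2), (25,2,2,5,2), (19,10,2,2,3),
     (22,10,4,3,0), (31,8,0,4,0), (25,16,0,1,1), (29,6,5,0,2), (22,3,4,3,3), (15,0,3,6,4), (19,11,6,1,1),
     (28,9,2,2,1), (21,6,1,5,2), (14,3,0,8,3), (18,1,2,0,9), (22,4,8,2,1), (15,1,7,5,2), (25,10,4,0,2),
     (18,7,3,3,3), (18,5,0,7,2), (23,6,6,0,3), (16,3,5,3,4), (35,4,4,2,0), (28,1,3,5,1), (22,9,3,2,2),
     (15,6,2,5,3), (17,5,3,1,6), (36,6,2,0,2), (20,3,2,6,2), (21,12,0,4,1), (28,4,10,0,0), (37,2,6,1,0),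
     (21,7,3,0,5), (31,8,3,2,0), (15,5,3,8,0), (25,14,0,3,0), (15,2,9,0,5), (24,0,5,1,5), (43,1,4,0,1),
     (28,9,5,0,1), (37,7,1,1,1), (21,4,1,7,1), (26,5,7,0,2), (35,3,3,1,2), (19,8,0,0,7), (29,9,0,2,2),
     (20,0,13,0,2), (17,4,2,0,8), (21,7,8,2,0), (30,5,4,3,0), (24,13,4,0,1), (33,11,0,1,1), (17,8,0,7,1),
     (33,0,9,0,1), (18,8,10,0,1), (27,6,6,1,1), (36,4,2,2,1), (20,1,2,8,1), (21,10,0,6,0), (21,1,12,1,1),
     (46,0,5,0,0), (31,8,6,0,0), (40,6,2,1,0), (24,3,2,7,0), (29,4,8,0,1), (38,2,4,1,1), (22,7,1,0,6),
     (16,7,4,4,2), (25,5,0,5,2), (20,3,3,0,7), (30,4,3,2,2), (14,1,3,8,2), (24,10,0,3,2), (22,2,11,2,0),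
     (31,0,7,3,0), (15,5,4,2,5), (24,3,0,3,5), (18,3,3,7,1), (28,12,0,2,1), (19,3,13,0,1), (28,1,9,1,1),
     (53,0,2,0,0), (22,7,6,2,1), (31,5,2,3,1), (15,2,2,9,1), (19,0,4,1,7), (29,1,4,3,2), (30,10,2,1,1),
     (34,0,7,0,2), (19,8,8,0,2), (18,3,1,3,6), (28,4,1,5,1), (17,4,10,0,3), (32,0,0,1,6), (26,0,3,5,2),
     (36,9,0,0,2), (20,6,0,6,2), (15,4,3,1,7), (25,5,3,3,2), (25,3,0,7,1), (13,0,5,1,8), (23,1,5,3,3),
     (24,10,3,1,2), (24,8,0,5,1), (31,0,10,1,0), (21,3,1,0,8), (15,3,4,4,4), (15,1,1,8,3), (20,2,7,1,4),
     (45,1,0,0,3), (30,9,1,0,3), (22,18,0,1,1), (26,8,5,0,2), (26,6,2,4,1), (27,15,0,2,0), (18,6,13,0,0),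
     (33,2,3,1,3), (18,10,4,1,3), (18,8,1,5,2), (25,0,11,1,1), (15,3,2,0,9), (35,7,5,0,0), (19,4,5,6,0),
     (29,13,2,1,0), (17,2,10,2,2), (42,1,3,1,1), (27,9,4,1,1), (27,7,1,5,0), (22,5,4,0,5), (32,6,4,2,0),
     (16,3,4,8,0), (20,1,6,0,6), (30,2,6,2,1), (30,0,3,6,0), (19,0,12,1,2), (16,4,1,1,8), (26,5,1,3,3),
     (18,14,0,4,1), (14,0,3,1,9), (34,4,6,1,0), (19,12,7,1,0), (23,2,12,0,1), (23,0,9,4,0), (23,6,3,1,4),
     (23,4,0,5,3), (18,2,3,0,8), (28,3,3,2,3), (28,1,0,6,2), (21,21,0,1,0), (42,0,2,0,3), (27,8,3,0,3),
     (27,6,0,4,2), (12,1,0,1,11), (22,2,0,3,6), (32,3,0,5,1), (17,11,1,5,1), (23,0,7,0,5), (33,1,7,2,0),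
     (18,9,8,2,0), (25,16,0,0,2), (19,3,2,1,7), (29,4,2,3,2), (30,13,0,1,1), (18,2,8,2,3), (18,0,5,6,2),
     (19,9,3,4,1), (19,7,0,8,0), (17,7,8,0,3), (17,5,5,4,2), (17,3,2,8,1), (18,12,0,6,0), (24,1,6,1,4),
     (15,7,1,1,7), (25,8,1,3,2), (23,0,12,2,0), (30,7,4,0,2), (30,5,1,4,1), (15,0,1,1,10), (25,1,1,3,5),
     (35,2,1,5,0), (20,10,2,5,0), (33,0,6,1,2), (24,6,1,1,5), (17,5,3,0,7), (17,3,0,4,6), (28,15,1,0,1),
     (15,1,5,0,8), (41,3,2,0,2), (16,8,0,2,6), (17,9,1,7,0), (46,0,2,1,1), (21,5,0,3,5), (24,7,5,0,3),
     (24,5,2,4,2), (25,14,0,2,1), (22,3,7,0,4), (22,1,4,4,3), (23,10,2,2,2), (24,19,0,0,1), (30,0,9,2,0),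
     (21,6,4,2,3), (21,4,1,6,2), (16,2,4,1,7), (16,0,1,5,6), (27,12,2,1,1), (15,1,10,2,3), (31,0,4,4,1),
     (32,9,2,2,0), (23,0,15,0,0), (20,4,4,0,6), (20,2,1,4,5), (31,14,2,0,0), (18,0,6,0,7), (44,2,3,0,1),
     (44,0,0,4,0), (24,0,10,2,1), (25,9,8,0,0), (15,4,2,6,3), (27,6,6,0,2), (17,1,0,6,5), (28,13,1,2,0),
     (19,4,14,0,0), (25,0,5,4,2), (26,9,3,2,1), (17,0,16,0,1), (21,5,3,1,5), (20,15,0,3,1), (16,1,3,0,9),
     (42,3,0,0,3), (17,0,1,9,2), (15,0,9,1,5), (47,0,0,1,2), (23,8,2,4,1), (24,17,0,2,0), (21,6,7,0,3),
     (37,5,1,2,1), (17,5,11,0,2), (33,4,5,2,0), (24,10,0,2,3), (22,2,11,1,1), (19,6,0,1,7), (20,7,1,6,1),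
     (14,2,0,0,11), (25,6,4,3,1), (26,15,2,1,0), (30,5,7,0,1), (20,0,1,6,4), (26,4,11,0,0), (32,0,2,4,2),
     (33,9,0,2,1), (19,7,4,0,5), (17,6,0,8,1), (21,4,2,0,7), (22,5,3,5,1), (23,14,1,3,0), (20,3,8,1,3),
     (36,2,2,3,1), (37,11,0,1,0), (25,0,8,2,2), (26,9,6,0,1), (37,0,9,0,0), (28,6,4,0,3), (19,4,2,7,1),
     (20,13,0,5,0), (32,0,0,0,7), (18,11,5,1,2), (22,1,10,0,3), (38,0,4,2,1), (20,6,0,5,3), (15,4,3,0,8),
     (16,5,4,5,2), (17,1,1,0,10), (28,5,5,3,0), (19,11,0,3,3), (16,0,7,1,6), (17,1,8,6,0), (24,8,0,4,2),
     (31,0,10,0,1), (22,6,5,0,4), (29,5,0,5,1), (18,5,9,0,3), (34,4,3,2,1), (20,2,7,0,5), (36,1,1,2,3),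
     (28,10,0,3,1), (32,0,5,2,2), (23,6,0,2,5), (44,0,6,0,0), (35,6,1,0,3), (27,15,0,1,1), (14,1,4,1,8),
     (15,2,5,6,2), (32,12,0,2,0), (29,1,7,0,3), (20,7,2,0,6), (21,8,3,5,0), (16,6,6,0,5), (32,5,0,2,3),
     (18,3,4,0,7), (19,4,5,5,1), (20,0,2,0,9), (21,1,3,5,3), (17,2,10,1,3), (33,1,4,3,1), (15,7,0,6,3),
     (38,0,7,0,1), (29,6,2,0,4), (20,4,0,7,2), (19,7,12,0,0), (25,3,3,4,2), (16,1,1,11,0), (30,2,6,1,2),
     (21,0,4,8,0), (19,0,12,0,3), (51,0,3,0,0), (17,5,2,5,3), (19,4,3,1,6), (20,5,4,6,0), (14,0,3,0,10),
     (15,1,4,5,4), (23,11,0,4,1), (30,3,10,0,0), (28,10,3,1,1), (32,0,8,0,2), (13,3,0,2,9), (14,4,1,7,3),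
     (19,5,7,0,4), (26,4,2,5,1), (21,2,5,0,6), (22,3,6,5,0), (21,21,0,0,1), (33,0,3,2,3), (25,9,2,3,1),
     (45,0,4,0,1), (21,8,6,3,0), (12,1,0,0,12), (13,2,1,5,6), (14,3,2,10,0), (28,4,7,0,2), (19,2,5,7,0),
     (24,3,11,0,1), (21,7,0,0,7), (20,2,15,0,0)]"
    by simp
qed simp

section \<open>Counting summands by greedy subtraction\<close>

definition golay_sum :: "nat \<Rightarrow> nat \<Rightarrow> bool" where
  "golay_sum l u \<longleftrightarrow> (\<exists>ms. length ms \<le> l \<and> (\<forall>m\<in>set ms. complex_golay_number m) \<and> sum_list ms = u)"

lemma golay_sum_0: "golay_sum l 0"
  by (auto simp: golay_sum_def intro!: exI[of _ "[]"])

lemma golay_sum_mono: "golay_sum l u \<Longrightarrow> l \<le> l' \<Longrightarrow> golay_sum l' u"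
  unfolding golay_sum_def using le_trans by blast

lemma golay_sum_Suc:
  assumes "complex_golay_number g" "g \<le> u" "golay_sum l (u - g)"
  shows "golay_sum (Suc l) u"
proof -
  obtain ms where "length ms \<le> l" "\<forall>m\<in>set ms. complex_golay_number m" "sum_list ms = u - g"
    using assms(3) by (auto simp: golay_sum_def)
  then show ?thesis using assms(1,2) unfolding golay_sum_def by (intro exI[of _ "g # ms"]) auto
qed

text \<open>One greedy step: above \<open>G\<close> some chain element leaves a remainder of at most
  \<open>G\<close>. The bound \<open>p \<le> Suc G\<close> lets the chain take over right where the
  old range ends.\<close>

lemma golay_sum_chain:
  assumes G: "\<forall>u\<le>G. golay_sum l u" and p: "complex_golay_number p" "p \<le> Suc G"
    and chain: "golay_chain G E p xs"
  shows "\<forall>u\<le>E. golay_sum (Suc l) u"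
proof (intro allI impI)
  fix u assume u: "u \<le> E"
  show "golay_sum (Suc l) u"
  proof (cases "u \<le> G")
    case True
    then show ?thesis using G golay_sum_mono[of l u "Suc l"] by simp
  next
    case False
    then obtain g where "complex_golay_number g" "g \<le> u" "u \<le> g + G"
      using golay_chain_covers[OF chain p(1), of 1 u] u p(2) by auto
    then show ?thesis using G by (intro golay_sum_Suc[of g]) auto
  qed
qed

definition net_table :: "(nat \<times> nat) set" where
  "net_table = {(3, 8), (4, 12), (5, 16), (6, 23), (7, 31), (8, 40), (9, 57)}"

lemma golay_net_table: "(i, n0) \<in> net_table \<Longrightarrow> golay_net i n0"
  unfolding net_table_def
  using golay_net_3 golay_net_4 golay_net_5 golay_net_6 golay_net_7 golay_net_8 golay_net_9 by auto

text \<open>A net with gain \<open>i\<close> can raise the exponent by \<open>i + 1\<close>, because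
  octave \<open>n\<close> extends to \<open>2 ^ (n + 1)\<close>: octaves \<open>x\<close> to
  \<open>x + i\<close> are all brought down to \<open>2 ^ x\<close>. This is why gain 9 means ten
  digits per step.\<close>

lemma golay_sum_net:
  assumes B: "\<forall>u\<le>2 ^ x. golay_sum l u"
    and net: "\<And>n. x \<le> n \<Longrightarrow> n < y \<Longrightarrow> \<exists>(i, n0)\<in>net_table. n0 \<le> n \<and> n \<le> x + i"
  shows "\<forall>u\<le>2 ^ y. golay_sum (Suc l) u"
proof (intro allI impI)
  fix u :: nat assume u: "u \<le> 2 ^ y"
  show "golay_sum (Suc l) u"
  proof (cases "u \<le> 2 ^ x")
    case True
    then show ?thesis using B golay_sum_mono[of l u "Suc l"] by simp
  next
    case False
    then have "2 \<le> u" using one_le_power[of "2::nat" x] by linarith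
    \<comment> \<open>The strict lower end places \<open>u = 2 ^ y\<close> in octave
      \<open>y - 1\<close>, so that \<open>n < y\<close> holds.\<close>
    then obtain n where n: "2 ^ n < u" "u \<le> 2 ^ (n + 1)" using ex_power_ivl2[of 2 u] by auto
    have "(2::nat) ^ x < 2 ^ (n + 1)" using n False by linarith
    then have "x \<le> n" using power_less_imp_less_exp[of "2::nat" x "n + 1"] by simp
    moreover have "(2::nat) ^ n < 2 ^ y" using n u by linarith
    then have "n < y" using power_less_imp_less_exp[of "2::nat" n y] by simp
    ultimately obtain i n0 where i: "golay_net i n0" "n0 \<le> n" "n \<le> x + i" using net golay_net_table by blast
    have "2 ^ n \<le> u \<and> u \<le> 2 ^ Suc n" using n by simp
    with i obtain g where g: "complex_golay_number g" "g \<le> u" "u - g \<le> 2 ^ (n - i)"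
      unfolding golay_net_def by blast
    have "(2::nat) ^ (n - i) \<le> 2 ^ x" using i(3) by (intro power_increasing) auto
    then have "golay_sum l (u - g)" using B g(3) by (meson le_trans)
    with g show ?thesis by (intro golay_sum_Suc)
  qed
qed

text \<open>Up to 6 every positive number is itself Golay; gaps of 6 lead from 6 to
  \<open>52 + 6 = 58\<close>, and gaps of 58 lead from 52 to \<open>216 + 58\<close>, beyond
  \<open>2 ^ 8\<close>.\<close>

lemma golay_sum_small: "\<forall>u\<le>2 ^ 8. golay_sum 3 u"
proof -
  note smooth = complex_golay_number_smooth
  have golay: "complex_golay_number 2" "complex_golay_number 4" "complex_golay_number 6" "complex_golay_number 52"
    using smooth[of 0 0 0 0 1] smooth[of 0 0 0 0 2] smooth[of 1 0 0 0 1] smooth[of 0 0 0 1 2] by simp_all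
  have 1: "\<forall>u\<le>6. golay_sum (Suc 0) u"
  proof (intro allI impI)
    fix u :: nat assume "u \<le> 6"
    then have "u = 0 \<or> u = 1 \<or> u = 2 \<or> u = 3 \<or> u = 4 \<or> u = 5 \<or> u = 6" by linarith
    then have "u = 0 \<or> complex_golay_number u"
      using golay complex_golay_number_1 complex_golay_number_3 complex_golay_number_5 by (elim disjE) simp_all
    then show "golay_sum (Suc 0) u"
      using golay_sum_Suc[of u u 0] by (auto simp: golay_sum_0)
  qed
  have 2: "\<forall>u\<le>58. golay_sum (Suc (Suc 0)) u"
    by (rule golay_sum_chain[OF 1 golay(3), where
      xs = "[(2,1,0,0,0), (1,2,0,0,0), (3,1,0,0,0), (1,1,1,0,0), (2,2,0,0,0),
        (3,0,1,0,0), (2,0,0,1,0), (1,0,2,0,0), (2,0,0,0,1)]"]) simp_all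
  have "\<forall>u\<le>2 ^ 8. golay_sum (Suc (Suc (Suc 0))) u"
    by (rule golay_sum_chain[OF 2 golay(4), where
      xs = "[(1,0,1,1,0), (5,0,1,0,0), (3,3,0,0,0)]"]) simp_all
  then show ?thesis by (simp only: numeral_3_eq_3)
qed

text \<open>With 3 to 9 summands the exponents reached are 8, 12, 17, 24, 32, 41, 50. From five
  summands on they are at least 10, 20, 30, 40, 50, and afterwards each summand adds ten.\<close>

lemma golay_sum_power_1024: "1 \<le> j \<Longrightarrow> \<forall>u\<le>2 ^ (10 * j). golay_sum (4 + j) u"
proof -
  have 4: "\<forall>u\<le>2 ^ 12. golay_sum (Suc 3) u"
    by (rule golay_sum_net[OF golay_sum_small]) (auto simp: net_table_def)
  have 5: "\<forall>u\<le>2 ^ 17. golay_sum (Suc (Suc 3)) u"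
    by (rule golay_sum_net[OF 4]) (auto simp: net_table_def)
  have 6: "\<forall>u\<le>2 ^ 24. golay_sum (Suc (Suc (Suc 3))) u"
    by (rule golay_sum_net[OF 5]) (auto simp: net_table_def)
  have 7: "\<forall>u\<le>2 ^ 32. golay_sum (Suc (Suc (Suc (Suc 3)))) u"
    by (rule golay_sum_net[OF 6]) (auto simp: net_table_def)
  have 8: "\<forall>u\<le>2 ^ 41. golay_sum (Suc (Suc (Suc (Suc (Suc 3))))) u"
    by (rule golay_sum_net[OF 7]) (auto simp: net_table_def)
  have 9: "\<forall>u\<le>2 ^ 50. golay_sum (Suc (Suc (Suc (Suc (Suc (Suc 3)))))) u"
    by (rule golay_sum_net[OF 8]) (auto simp: net_table_def)
  have large: "\<forall>u\<le>2 ^ (10 * (5 + t)). golay_sum (9 + t) u" for t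
  proof (induction t)
    case 0
    have "10 * (5 + 0) = (50::nat)" "9 + 0 = Suc (Suc (Suc (Suc (Suc (Suc 3)))))" by simp_all
    then show ?case using 9 by (simp only:)
  next
    case (Suc t)
    \<comment> \<open>The step from 50 to 60 can use gain 8 for octaves up to 58 and gain 9 for
      octave 59; from 60 on gain 9, valid from octave 57, suffices alone.\<close>
    have "\<forall>u\<le>2 ^ (10 * (5 + Suc t)). golay_sum (Suc (9 + t)) u"
      by (rule golay_sum_net[OF Suc.IH]) (auto simp: net_table_def)
    then show ?case by (simp only: add_Suc_right)
  qed
  have weaken: "\<forall>u\<le>2 ^ (10 * j). golay_sum (4 + j) u"
    if "\<forall>u\<le>2 ^ y. golay_sum l u" "10 * j \<le> y" "l = 4 + j" for y l
    using that(1,3) power_increasing[OF that(2), of "2::nat"] by (metis one_le_numeral order_trans)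
  assume "1 \<le> j"
  then have "j = 1 \<or> j = 2 \<or> j = 3 \<or> j = 4 \<or> j = 5 + (j - 5)" by auto
  then consider "j = 1" | "j = 2" | "j = 3" | "j = 4" | t where "j = 5 + t"
    by blast
  then show "\<forall>u\<le>2 ^ (10 * j). golay_sum (4 + j) u"
  proof cases
    case 1 then show ?thesis by (intro weaken[OF 5]) auto
  next
    case 2 then show ?thesis by (intro weaken[OF 6]) auto
  next
    case 3 then show ?thesis by (intro weaken[OF 7]) auto
  next
    case 4 then show ?thesis by (intro weaken[OF 8]) auto
  next
    case 5 then show ?thesis using large by simp
  qed
qed

lemma golay_list_short:
  assumes "0 < u"
  shows "\<exists>ms. real (length ms) \<le> lg u / 10 + 5 \<and> (\<forall>m\<in>set ms. complex_golay_number m) \<and> sum_list ms = u"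
proof -
  \<comment> \<open>Here \<open>t\<close> is the integer part of \<open>lg u / 10\<close>; taking
    \<open>j = t + 1\<close> below gives \<open>t + 5\<close> summands.\<close>
  obtain t where t: "1024 ^ t \<le> u" "u < 1024 ^ (t + 1)"
    using ex_power_ivl1[of 1024 u] assms by auto
  have e: "(1024::nat) ^ i = 2 ^ (10 * i)" for i by (simp add: power_mult)
  have "u \<le> 2 ^ (10 * (t + 1))" using t(2) unfolding e by simp
  then have "golay_sum (4 + (t + 1)) u" using golay_sum_power_1024[of "t + 1"] by simp
  moreover have "real (10 * t) \<le> log 2 (real u)"
    using t(1) unfolding e by (intro le_log_of_power) (simp_all flip: of_nat_power_le_of_nat_cancel_iff)
  then have "real (4 + (t + 1)) \<le> lg u / 10 + 5" using assms by (simp add: lg_def)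
  ultimately show ?thesis unfolding golay_sum_def by (metis of_nat_le_iff order_trans)
qed

text \<open>Bridges the gap between the bound for \<open>v 1\<close> and the term
  \<open>lg (v 1 - 1)\<close> of the final estimate; at \<open>u = 1\<close> the convention
  \<open>lg 0 = 0\<close> enters.\<close>

lemma lg_pred: "0 < u \<Longrightarrow> lg u \<le> lg (u - 1) + 1"
proof (cases "u = 1")
  case False
  assume "0 < u"
  with False have "2 \<le> u" by simp
  then have "log 2 (real u) \<le> log 2 (2 * real (u - 1))" by simp
  also have "\<dots> = 1 + log 2 (real (u - 1))" using \<open>2 \<le> u\<close> by (subst log_mult) auto
  finally show ?thesis using \<open>2 \<le> u\<close> by (simp add: lg_def)
qed (simp add: lg_def)

subsection \<open>Anti-amicable families\<close>

definition row_ip :: "nat \<Rightarrow> (nat \<Rightarrow> nat \<Rightarrow> complex) \<Rightarrow> (nat \<Rightarrow> nat \<Rightarrow> complex) \<Rightarrow> nat \<Rightarrow> nat \<Rightarrow> complex" where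
  "row_ip n A B v w = (\<Sum>j<n. A v j * cnj (B w j))"

text \<open>Since \<open>row_ip n A B\<close> is the product of \<open>A\<close> with the adjoint of
  \<open>B\<close>, the condition at \<open>c = d\<close> makes each \<open>M c\<close> a complex
  Hadamard matrix; at distinct indices the two mixed products are negatives of each other.\<close>

definition anti_amicable_family :: "nat \<Rightarrow> nat \<Rightarrow> (nat \<Rightarrow> nat \<Rightarrow> nat \<Rightarrow> complex) \<Rightarrow> bool" where
  "anti_amicable_family q n M \<longleftrightarrow>
     (\<forall>c<q. \<forall>v<n. \<forall>w<n. M c v w \<in> quartic_units) \<and>
     (\<forall>c<q. \<forall>d<q. \<forall>v<n. \<forall>w<n. row_ip n (M c) (M d) v w + row_ip n (M d) (M c) v w
        = (if c = d \<and> v = w then of_nat (2 * n) else 0))"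

definition kron2 :: "(nat \<Rightarrow> nat \<Rightarrow> complex) \<Rightarrow> (nat \<Rightarrow> nat \<Rightarrow> complex) \<Rightarrow> nat \<Rightarrow> nat \<Rightarrow> complex" where
  "kron2 A K v w = A (v div 2) (w div 2) * K (v mod 2) (w mod 2)"

text \<open>The tensor identity of generating polynomials at \<open>z = 1\<close>, applied to the
  products along two rows.\<close>

lemma row_ip_kron2:
  "row_ip (n * 2) (kron2 A K) (kron2 B L) v w = row_ip n A B (v div 2) (w div 2) * row_ip 2 K L (v mod 2) (w mod 2)"
  using gen_tensor[of n 2 "\<lambda>j. A (v div 2) j * cnj (B (w div 2) j)" "\<lambda>j. K (v mod 2) j * cnj (L (w mod 2) j)" 1]
  by (simp add: gen_def row_ip_def kron2_def algebra_simps)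

definition mat2 :: "complex \<Rightarrow> complex \<Rightarrow> complex \<Rightarrow> complex \<Rightarrow> nat \<Rightarrow> nat \<Rightarrow> complex" where
  "mat2 a b c d v w = (if v = 0 then if w = 0 then a else b else if w = 0 then c else d)"

text \<open>Up to signs, the Hadamard matrix \<open>mat2 1 1 1 (-1)\<close> multiplied by the Pauli matrix \<open>X\<close>
  and by \<open>-\<i> Z\<close>, \<open>-\<i> Y\<close> and the identity.\<close>

definition pauli :: "nat \<Rightarrow> nat \<Rightarrow> nat \<Rightarrow> complex" where
  "pauli t = (if t = 0 then mat2 1 (-1) 1 1 else if t = 1 then mat2 (-\<i>) (-\<i>) \<i> (-\<i>)
     else if t = 2 then mat2 (-1) 1 1 1 else mat2 1 1 1 (-1))"

lemma row_ip_pauli: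
  assumes "v < 2" "w < 2"
  shows "row_ip 2 (pauli 0) (pauli 0) v w = (if v = w then 2 else 0)"
    and "t < 4 \<Longrightarrow> row_ip 2 (pauli 0) (pauli t) v w = row_ip 2 (pauli t) (pauli 0) v w"
    and "t \<in> {1,2,3} \<Longrightarrow> u \<in> {1,2,3} \<Longrightarrow>
      row_ip 2 (pauli t) (pauli u) v w + row_ip 2 (pauli u) (pauli t) v w = (if t = u \<and> v = w then 4 else 0)"
proof -
  have vw: "v = 0 \<or> v = 1" "w = 0 \<or> w = 1" using assms by auto
  have s: "row_ip 2 K L v w = K v 0 * cnj (L w 0) + K v 1 * cnj (L w 1)" for K L v w
    by (simp add: row_ip_def numeral_2_eq_2)
  show "row_ip 2 (pauli 0) (pauli 0) v w = (if v = w then 2 else 0)"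
    using vw by (auto simp: s pauli_def mat2_def)
  show "row_ip 2 (pauli 0) (pauli t) v w = row_ip 2 (pauli t) (pauli 0) v w" if "t < 4"
  proof -
    have "t = 0 \<or> t = 1 \<or> t = 2 \<or> t = 3" using that by auto
    then show ?thesis using vw by (elim disjE) (simp_all add: s pauli_def mat2_def)
  qed
  show "row_ip 2 (pauli t) (pauli u) v w + row_ip 2 (pauli u) (pauli t) v w = (if t = u \<and> v = w then 4 else 0)"
    if "t \<in> {1,2,3}" "u \<in> {1,2,3}"
  proof -
    have "t = 1 \<or> t = 2 \<or> t = 3" "u = 1 \<or> u = 2 \<or> u = 3" using that by auto
    then show ?thesis using vw by (elim disjE) (simp_all add: s pauli_def mat2_def)
  qed
qed

lemma pauli_units: "pauli t v w \<in> quartic_units"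
  by (simp add: pauli_def mat2_def quartic_units_def)

text \<open>All members but the last are tensored with \<open>pauli 0\<close>, the last one with
  each of \<open>pauli 1\<close>, \<open>pauli 2\<close>, \<open>pauli 3\<close>, as
  \<open>min\<close> and truncated subtraction encode; doubling the order thus gains two members. An
  early and a late member cancel in the first factor, because \<open>pauli 0\<close> is amicable
  with the others; two late ones cancel in the second factor, since \<open>M q\<close> is
  Hadamard.\<close>

lemma anti_amicable_double:
  assumes M: "anti_amicable_family (Suc q) n M"
  shows "anti_amicable_family (q + 3) (n * 2)
    (\<lambda>c. kron2 (M (min c q)) (pauli (c + 1 - q)))"
  (is "anti_amicable_family _ _ ?N")
  unfolding anti_amicable_family_def
proof (intro conjI allI impI)
  fix c v w assume "c < q + 3" "v < n * 2" "w < n * 2"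
  then show "?N c v w \<in> quartic_units"
    using M by (auto simp: kron2_def anti_amicable_family_def intro!: quartic_units_mult pauli_units)
next
  fix c d v w assume c: "c < q + 3" and d: "d < q + 3" and v: "v < n * 2" and w: "w < n * 2"
  let ?v = "v div 2" and ?w = "w div 2" and ?x = "v mod 2" and ?y = "w mod 2"
  have vw: "v = w \<longleftrightarrow> ?v = ?w \<and> ?x = ?y" using div_mult_mod_eq[of v 2] div_mult_mod_eq[of w 2] by metis
  have ip: "row_ip n (M i) (M j) ?v ?w + row_ip n (M j) (M i) ?v ?w = (if i = j \<and> ?v = ?w then of_nat (2 * n) else 0)"
    if "i < Suc q" "j < Suc q" for i j
    using M that v w unfolding anti_amicable_family_def by (simp add: less_mult_imp_div_less)
  have ip_diag: "row_ip n (M q) (M q) ?v ?w = (if ?v = ?w then of_nat n else 0)"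
    using ip[of q q] by (auto simp: mult_2[symmetric] split: if_splits)
  have xy: "?x < 2" "?y < 2" by auto
  note P = row_ip_pauli[OF xy]
  have tri: "e - q + 1 \<in> {1, 2, 3}" "e + 1 - q = e - q + 1" "min e q = q" if "e < q + 3" "\<not> e < q" for e
    using that by auto
  have low: "e + 1 - q = 0" "min e q = e" if "e < q" for e using that by auto
  show "row_ip (n * 2) (?N c) (?N d) v w + row_ip (n * 2) (?N d) (?N c) v w
      = (if c = d \<and> v = w then of_nat (2 * (n * 2)) else 0)"
  proof (cases "c < q"; cases "d < q")
    assume *: "c < q" "d < q"
    show ?thesis unfolding row_ip_kron2 vw low[OF *(1)] low[OF *(2)] P(1)
      using ip[of c d] * by (simp add: distrib_right[symmetric])
  next
    assume *: "c < q" "\<not> d < q"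
    have "row_ip n (M c) (M q) ?v ?w + row_ip n (M q) (M c) ?v ?w = 0" using ip[of c q] * by simp
    then show ?thesis unfolding row_ip_kron2 vw low[OF *(1)] tri(2,3)[OF d *(2)]
      using P(2)[of "d - q + 1"] d * by (simp add: distrib_right[symmetric])
  next
    assume *: "\<not> c < q" "d < q"
    have "row_ip n (M q) (M d) ?v ?w + row_ip n (M d) (M q) ?v ?w = 0" using ip[of q d] * by simp
    then show ?thesis unfolding row_ip_kron2 vw low[OF *(2)] tri(2,3)[OF c *(1)]
      using P(2)[of "c - q + 1"] c * by (simp add: distrib_right[symmetric])
  next
    assume *: "\<not> c < q" "\<not> d < q"
    have "c - q + 1 = d - q + 1 \<longleftrightarrow> c = d" using * by auto
    then show ?thesis unfolding row_ip_kron2 vw tri(2,3)[OF c *(1)] tri(2,3)[OF d *(2)] ip_diag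
      using P(3)[OF tri(1)[OF c *(1)] tri(1)[OF d *(2)]] by (simp add: distrib_left[symmetric])
  qed
qed

lemma anti_amicable_family_exists: "\<exists>M. anti_amicable_family (2 * m + 2) (2 ^ m) M"
proof (induction m)
  case 0
  \<comment> \<open>The matrices 1 and \<open>\<i>\<close> of order 1 satisfy
    \<open>1 * cnj \<i> + \<i> * 1 = 0\<close>.\<close>
  have "anti_amicable_family 2 1 (\<lambda>c v w. if c = 0 then 1 else \<i>)"
    by (auto simp: anti_amicable_family_def quartic_units_def row_ip_def less_2_cases_iff)
  then show ?case by (intro exI[of _ "\<lambda>c v w. if c = 0 then 1 else \<i>"]) (simp add: numeral_2_eq_2)
next
  case (Suc m)
  then obtain M where "anti_amicable_family (Suc (2 * m + 1)) (2 ^ m) M" by auto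
  from anti_amicable_double[OF this] show ?case by (auto simp: mult.commute numeral_eq_Suc)
qed

subsection \<open>The block-circulant design\<close>

text \<open>
  The \<open>p\<close> Golay pairs are concatenated to two sequences \<open>A\<close>, \<open>B\<close> of length \<open>s\<close>, and \<open>pc i\<close> is the
  pair to which position \<open>i\<close> belongs. On the integers modulo \<open>N = 2 s\<close> the sequences are continued by
  \<open>U (N - 1 - t) = cnj (U t)\<close>, with \<open>A\<close>, \<open>\<i> A\<close>, \<open>B\<close>, \<open>\<i> B\<close> in four separate copies indexed by two
  booleans: the products of an original with a conjugated entry cancel between \<open>A\<close> and \<open>\<i> A\<close>.
\<close>

locale golay_layout =
  fixes s p :: nat and A B :: "nat \<Rightarrow> complex" and pc :: "nat \<Rightarrow> nat"
  assumes units: "i < s \<Longrightarrow> A i \<in> quartic_units" "i < s \<Longrightarrow> B i \<in> quartic_units"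
    and pc_less: "i < s \<Longrightarrow> pc i < p"
    and corr: "1 \<le> j \<Longrightarrow> (\<Sum>i<s. if i + j < s \<and> pc i = q \<and> pc (i + j) = q
        then A (i + j) * cnj (A i) + B (i + j) * cnj (B i) else 0) = 0"
begin

definition N :: int where "N = 2 * int s"

definition half :: "int \<Rightarrow> nat" where
  "half t = nat (if t < int s then t else N - 1 - t)"

definition U :: "bool \<Rightarrow> bool \<Rightarrow> int \<Rightarrow> complex" where
  "U e e' t = (let a = (if e then \<i> else 1) * (if e' then B else A) (half t)
     in if t < int s then a else cnj a)"

lemma half_less: "t \<in> {0..<N} \<Longrightarrow> half t < s"
  by (auto simp: half_def N_def)

lemma half_reflect: "t \<in> {0..<N} \<Longrightarrow> half (N - 1 - t) = half t"
  by (auto simp: half_def N_def)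

lemma U_reflect: "t \<in> {0..<N} \<Longrightarrow> U e e' (N - 1 - t) = cnj (U e e' t)"
  unfolding U_def half_reflect by (auto simp: Let_def N_def)

lemma U_units: "t \<in> {0..<N} \<Longrightarrow> U e e' t \<in> quartic_units"
  using half_less[of t] units[of "half t"]
  by (auto simp: U_def Let_def intro!: quartic_units_mult quartic_units_cnj) (auto simp: quartic_units_def)

text \<open>The cycle is twice as long as the sequences, so one shift never produces direct and
  wrapped-around products at once: only direct ones for \<open>h < s\<close>, only wrapped ones for
  \<open>h \<ge> s\<close>. Either sum is an aperiodic correlation or its conjugate.\<close>

lemma corr_direct:
  assumes h: "1 \<le> h" "h < 2 * s"
  shows "(\<Sum>i<s. if (i + h) mod (2 * s) < s \<and> pc i = q \<and> pc ((i + h) mod (2 * s)) = q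
     then A i * cnj (A ((i + h) mod (2 * s))) + B i * cnj (B ((i + h) mod (2 * s))) else 0) = 0"
    (is "?L = 0")
proof (cases "h < s")
  case True
  have "?L = cnj (\<Sum>i<s. if i + h < s \<and> pc i = q \<and> pc (i + h) = q
        then A (i + h) * cnj (A i) + B (i + h) * cnj (B i) else 0)"
    unfolding cnj_sum using True by (intro sum.cong) (auto simp: mult.commute)
  then show ?thesis using corr h by simp
next
  case False
  define j where "j = 2 * s - h"
  have j: "1 \<le> j" "j \<le> s" "h = 2 * s - j" using h False by (auto simp: j_def)
  have m: "(i + h) mod (2 * s) = (if i < j then i + h else i - j)" if "i < s" for i
    using that j by (auto simp: mod_if)
  have m': "\<not> i + h < s" for i using False by simp
  have "?L = (\<Sum>i\<in>{j..<s}. if pc i = q \<and> pc (i - j) = q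
     then A i * cnj (A (i - j)) + B i * cnj (B (i - j)) else 0)"
    using m m' by (intro sum.mono_neutral_cong_right) auto
  also have "\<dots> = (\<Sum>i\<in>{..<s - j}. if pc i = q \<and> pc (i + j) = q
        then A (i + j) * cnj (A i) + B (i + j) * cnj (B i) else 0)"
    by (rule sum.reindex_bij_witness[of _ "\<lambda>i. i + j" "\<lambda>i. i - j"]) auto
  also have "\<dots> = (\<Sum>i<s. if i + j < s \<and> pc i = q \<and> pc (i + j) = q
        then A (i + j) * cnj (A i) + B (i + j) * cnj (B i) else 0)"
    by (intro sum.mono_neutral_cong_left) auto
  finally show ?thesis using corr j by simp
qed

text \<open>For \<open>e = True\<close>, products within one half carry the factor
  \<open>\<i> * cnj \<i> = 1\<close>, while products across the halves carry -1 and cancel against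
  \<open>e = False\<close>.\<close>

lemma U_same_colour:
  assumes "t \<in> {0..<N}" "t' \<in> {0..<N}"
  shows "(\<Sum>e\<in>UNIV. \<Sum>e'\<in>UNIV. U e e' t * cnj (U e e' t')) =
    (if t < int s \<and> t' < int s then 2 * (A (half t) * cnj (A (half t')) + B (half t) * cnj (B (half t')))
     else if t \<ge> int s \<and> t' \<ge> int s then 2 * cnj (A (half t) * cnj (A (half t')) + B (half t) * cnj (B (half t')))
     else 0)"
  by (simp add: UNIV_bool U_def Let_def algebra_simps)

text \<open>Across the halves nothing remains. The lower half is a correlation of the original
  entries, and the upper half becomes one after reflecting \<open>t\<close> to
  \<open>N - 1 - t\<close>, which turns the shift \<open>h\<close> into
  \<open>N - h\<close>.\<close>

lemma same_colour_sum:
  assumes h: "h \<in> {1..<N}"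
  shows "(\<Sum>t\<in>{0..<N}. if pc (half t) = q \<and> pc (half ((t + h) mod N)) = q
    then \<Sum>e\<in>UNIV. \<Sum>e'\<in>UNIV. U e e' t * cnj (U e e' ((t + h) mod N)) else 0) = 0"
proof -
  define f where "f i j = (if pc i = q \<and> pc j = q then A i * cnj (A j) + B i * cnj (B j) else 0)" for i j
  let ?t' = "\<lambda>t. (t + h) mod N"
  have N: "N > 0" using h by auto
  have m: "?t' t \<in> {0..<N}" for t using N by simp
  have direct: "(\<Sum>t\<in>{0..<int s}. if (t + h) mod N < int s then f (half t) (half ((t + h) mod N)) else 0) = 0"
    if "h \<in> {1..<N}" for h
  proof -
    have "(\<Sum>t\<in>{0..<int s}. if (t + h) mod N < int s then f (half t) (half ((t + h) mod N)) else 0)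
       = (\<Sum>i<s. if (i + nat h) mod (2 * s) < s then f i ((i + nat h) mod (2 * s)) else 0)"
    proof (rule sum.reindex_bij_witness[of _ int nat])
      fix t assume t: "t \<in> {0..<int s}"
      have "int ((nat t + nat h) mod (2 * s)) = (t + h) mod N"
        using t that by (simp add: N_def zmod_int)
      then show "(if (nat t + nat h) mod (2 * s) < s then f (nat t) ((nat t + nat h) mod (2 * s)) else 0)
         = (if (t + h) mod N < int s then f (half t) (half ((t + h) mod N)) else 0)"
        using t by (auto simp: half_def) (metis nat_int of_nat_less_iff)+
    qed auto
    also have "\<dots> = 0"
      by (rule trans[OF sum.cong[OF refl] corr_direct[of "nat h" q]]) (use that in \<open>auto simp: f_def N_def\<close>)
    finally show ?thesis .
  qed
  have refl: "(\<Sum>t\<in>{int s..<N}. if ?t' t \<ge> int s then f (half t) (half (?t' t)) else 0) = 0"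
  proof -
    have "(\<Sum>t\<in>{int s..<N}. if ?t' t \<ge> int s then f (half t) (half (?t' t)) else 0)
      = (\<Sum>t\<in>{0..<int s}. if (t + (N - h)) mod N < int s then f (half t) (half ((t + (N - h)) mod N)) else 0)"
    proof (rule sum.reindex_bij_witness[of _ "\<lambda>t. N - 1 - t" "\<lambda>t. N - 1 - t"])
      fix t assume t: "t \<in> {int s..<N}"
      have "(N - 1 - t + (N - h)) mod N = (N - 1 - (t + h) mod N) mod N"
        by (metis (no_types, opaque_lifting) add_diff_eq add.commute diff_diff_eq mod_add_self1 mod_diff_right_eq)
      also have "\<dots> = N - 1 - ?t' t" using m[of t] by (intro mod_pos_pos_trivial) auto
      finally have e: "(N - 1 - t + (N - h)) mod N = N - 1 - ?t' t" .
      have "t \<in> {0..<N}" using t by auto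
      then show "(if (N - 1 - t + (N - h)) mod N < int s then f (half (N - 1 - t)) (half ((N - 1 - t + (N - h)) mod N)) else 0)
         = (if ?t' t \<ge> int s then f (half t) (half (?t' t)) else 0)"
        unfolding e half_reflect[OF m] by (simp add: half_reflect) (auto simp: N_def)
    qed (auto simp: N_def)
    then show ?thesis using direct[of "N - h"] h by auto
  qed
  have split: "{0..<N} = {0..<int s} \<union> {int s..<N}" by (auto simp: N_def)
  have "(\<Sum>t\<in>{0..<N}. if pc (half t) = q \<and> pc (half (?t' t)) = q
    then \<Sum>e\<in>UNIV. \<Sum>e'\<in>UNIV. U e e' t * cnj (U e e' (?t' t)) else 0)
    = (\<Sum>t\<in>{0..<N}. if t < int s then (if ?t' t < int s then 2 * f (half t) (half (?t' t)) else 0)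
        else if ?t' t \<ge> int s then 2 * cnj (f (half t) (half (?t' t))) else 0)"
    using m by (intro sum.cong) (auto simp: U_same_colour f_def)
  also have "\<dots> = (\<Sum>t\<in>{0..<int s}. if ?t' t < int s then 2 * f (half t) (half (?t' t)) else 0)
      + (\<Sum>t\<in>{int s..<N}. if ?t' t \<ge> int s then 2 * cnj (f (half t) (half (?t' t))) else 0)"
    unfolding split by (subst sum.union_disjoint) (auto intro!: sum.cong arg_cong2[where f = plus])
  also have "\<dots> = 2 * (\<Sum>t\<in>{0..<int s}. if ?t' t < int s then f (half t) (half (?t' t)) else 0)
      + 2 * cnj (\<Sum>t\<in>{int s..<N}. if ?t' t \<ge> int s then f (half t) (half (?t' t)) else 0)"
    unfolding cnj_sum sum_distrib_left by (intro arg_cong2[where f = plus] sum.cong) auto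
  also have "\<dots> = 0" using direct[OF h] refl by simp
  finally show ?thesis .
qed

lemma card_half:
  "(\<Sum>t\<in>{0..<N}. if pc (half t) = q then 1 else 0 :: complex) = of_nat (2 * card {i. i < s \<and> pc i = q})"
proof -
  have split: "{0..<N} = {0..<int s} \<union> {int s..<N}" by (auto simp: N_def)
  have c: "(\<Sum>i<s. if pc i = q then 1 else 0 :: complex) = of_nat (card {i. i < s \<and> pc i = q})"
    by (simp add: sum.If_cases Int_def conj_commute)
  have 1: "(\<Sum>t\<in>{0..<int s}. if pc (half t) = q then 1 else 0 :: complex) = (\<Sum>i<s. if pc i = q then 1 else 0)"
    by (rule sum.reindex_bij_witness[of _ int nat]) (auto simp: half_def)
  have 2: "(\<Sum>t\<in>{int s..<N}. if pc (half t) = q then 1 else 0 :: complex) = (\<Sum>i<s. if pc i = q then 1 else 0)"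
    by (rule sum.reindex_bij_witness[of _ "\<lambda>i. N - 1 - int i" "\<lambda>t. nat (N - 1 - t)"]) (auto simp: half_def N_def)
  show ?thesis unfolding split by (subst sum.union_disjoint) (auto simp: 1 2 c)
qed

end

text \<open>
  Realification: multiplying the real \<open>2 \<times> 2\<close> matrix of \<open>z\<close> from the right by
  \<open>((1, 1), (-1, 1))\<close> turns every quartic unit into a matrix with entries \<open>\<plusminus>1\<close>.
\<close>

definition realify :: "bool \<Rightarrow> bool \<Rightarrow> complex \<Rightarrow> real" where
  "realify b b' z = (if b = b' then Re z + Im z else if b then Im z - Re z else Re z - Im z)"

text \<open>Entries of the real block \<open>((Re z, - Im z), (Im z, Re z))\<close>, with
  \<open>False\<close> indexing the first row and column.\<close>

definition re_part :: "bool \<Rightarrow> bool \<Rightarrow> complex \<Rightarrow> real" where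
  "re_part b b' z = (if b = b' then Re z else if b then Im z else - Im z)"

lemma realify_units: "z \<in> quartic_units \<Longrightarrow> realify b b' z \<in> {1, -1}"
  by (auto simp: quartic_units_def realify_def)

text \<open>The matrix \<open>((1, 1), (-1, 1))\<close> times its transpose is twice the identity,
  and the transposed block of \<open>z'\<close> is the block of \<open>cnj z'\<close>.\<close>

lemma realify_mult:
  "(\<Sum>c\<in>UNIV. realify b c z * realify b' c z') = 2 * re_part b b' (z * cnj z')"
  by (auto simp: UNIV_bool realify_def re_part_def algebra_simps)

lemma re_part_sum: "re_part b b' (\<Sum>i\<in>I. f i) = (\<Sum>i\<in>I. re_part b b' (f i))"
  by (auto simp: re_part_def sum_negf)

lemma re_part_add: "re_part b b' (x + y) = re_part b b' x + re_part b b' y"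
  by (auto simp: re_part_def)

lemma re_part_of_nat: "re_part b b' (of_nat n * x) = of_nat n * re_part b b' x"
  by (auto simp: re_part_def)

locale ring_embedding =
  fixes \<phi> :: "real \<Rightarrow> 'r::comm_ring_1"
  assumes \<phi>_1: "\<phi> 1 = 1" and \<phi>_add: "\<phi> (a + b) = \<phi> a + \<phi> b" and \<phi>_mult: "\<phi> (a * b) = \<phi> a * \<phi> b"
begin

lemma \<phi>_0: "\<phi> 0 = 0"
  using \<phi>_add[of 0 0] by simp

lemma \<phi>_sum: "\<phi> (\<Sum>i\<in>I. f i) = (\<Sum>i\<in>I. \<phi> (f i))"
  by (induction I rule: infinite_finite_induct) (auto simp: \<phi>_0 \<phi>_add)

lemma \<phi>_minus: "\<phi> (- a) = - \<phi> a"
  using \<phi>_add[of a "- a"] by (simp add: \<phi>_0 eq_neg_iff_add_eq_0 add.commute)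

lemma \<phi>_of_nat: "\<phi> (of_nat n) = of_nat n"
  by (induction n) (auto simp: \<phi>_0 \<phi>_1 \<phi>_add)

end

text \<open>The element \<open>x q\<close> is attached to piece \<open>q\<close>; pieces that serve
  the same \<open>v i\<close> will later share one variable. The map \<open>\<phi>\<close> will be
  the inclusion of the constants into the polynomials.\<close>

locale golay_design = golay_layout s p A B pc + ring_embedding \<phi>
  for s p A B pc and \<phi> :: "real \<Rightarrow> 'r::comm_ring_1" +
  fixes n :: nat and M :: "nat \<Rightarrow> nat \<Rightarrow> nat \<Rightarrow> complex" and x :: "nat \<Rightarrow> 'r"
  assumes M: "anti_amicable_family (4 * p) n M"
begin

text \<open>Blocks are indexed by the integers modulo \<open>N\<close> together with two booleans
  under exclusive or. Piece, unit and colour depend only on the difference of the two indices in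
  this group, so the design is group-developed.\<close>

definition shift :: "int \<times> bool \<times> bool \<Rightarrow> int \<times> bool \<times> bool \<Rightarrow> int" where
  "shift \<alpha> \<gamma> = (fst \<gamma> - fst \<alpha>) mod N"

definition piece :: "int \<times> bool \<times> bool \<Rightarrow> int \<times> bool \<times> bool \<Rightarrow> nat" where
  "piece \<alpha> \<gamma> = pc (half (shift \<alpha> \<gamma>))"

definition unit :: "int \<times> bool \<times> bool \<Rightarrow> int \<times> bool \<times> bool \<Rightarrow> complex" where
  "unit \<alpha> \<gamma> = U (fst (snd \<gamma>) \<noteq> fst (snd \<alpha>)) (snd (snd \<gamma>) \<noteq> snd (snd \<alpha>)) (shift \<alpha> \<gamma>)"

definition colour :: "int \<times> bool \<times> bool \<Rightarrow> int \<times> bool \<times> bool \<Rightarrow> nat" where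
  "colour \<alpha> \<gamma> = 4 * piece \<alpha> \<gamma> + (if fst (snd \<gamma>) \<noteq> fst (snd \<alpha>) then 2 else 0)
     + (if snd (snd \<gamma>) \<noteq> snd (snd \<alpha>) then 1 else 0)"

definition entry :: "(int \<times> bool \<times> bool) \<times> (bool \<times> nat) \<Rightarrow> (int \<times> bool \<times> bool) \<times> (bool \<times> nat) \<Rightarrow> complex" where
  "entry r c = unit (fst r) (fst c) * M (colour (fst r) (fst c)) (snd (snd r)) (snd (snd c))"

definition design :: "(int \<times> bool \<times> bool) \<times> (bool \<times> nat) \<Rightarrow> (int \<times> bool \<times> bool) \<times> (bool \<times> nat) \<Rightarrow> 'r" where
  "design r c = x (piece (fst r) (fst c)) * \<phi> (realify (fst (snd r)) (fst (snd c)) (entry r c))"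

definition blocks :: "(int \<times> bool \<times> bool) set" where
  "blocks = {0..<N} \<times> UNIV \<times> UNIV"

definition indices :: "((int \<times> bool \<times> bool) \<times> (bool \<times> nat)) set" where
  "indices = blocks \<times> (UNIV \<times> {..<n})"

text \<open>In the group this is \<gamma> \<mapsto> \<alpha> + \<beta> - 1 - \<gamma>, with the 1 in
  the cyclic part only, chosen to match the reflection
  \<open>U e e' (N - 1 - t) = cnj (U e e' t)\<close>.\<close>

definition swap :: "int \<times> bool \<times> bool \<Rightarrow> int \<times> bool \<times> bool \<Rightarrow> int \<times> bool \<times> bool \<Rightarrow> int \<times> bool \<times> bool" where
  "swap \<alpha> \<beta> \<gamma> = ((N - 1 + fst \<alpha> + fst \<beta> - fst \<gamma>) mod N,
     fst (snd \<gamma>) \<noteq> (fst (snd \<alpha>) \<noteq> fst (snd \<beta>)), snd (snd \<gamma>) \<noteq> (snd (snd \<alpha>) \<noteq> snd (snd \<beta>)))"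

lemma N_pos: "\<gamma> \<in> blocks \<Longrightarrow> N > 0"
  by (auto simp: blocks_def)

lemma shift_range: "N > 0 \<Longrightarrow> shift \<alpha> \<gamma> \<in> {0..<N}"
  by (simp add: shift_def)

lemma reflect_mod: "N > 0 \<Longrightarrow> (N - 1 - a) mod N = N - 1 - a mod N"
proof -
  assume N: "N > 0"
  have "(N - 1 - a) mod N = (N - 1 - a mod N) mod N" by (simp add: mod_diff_right_eq)
  also have "\<dots> = N - 1 - a mod N"
    using pos_mod_sign[OF N, of a] pos_mod_bound[OF N, of a] by (intro mod_pos_pos_trivial) auto
  finally show ?thesis .
qed

lemma shift_swap:
  assumes "N > 0"
  shows "shift \<alpha> (swap \<alpha> \<beta> \<gamma>) = N - 1 - shift \<beta> \<gamma>" "shift \<beta> (swap \<alpha> \<beta> \<gamma>) = N - 1 - shift \<alpha> \<gamma>"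
  unfolding shift_def reflect_mod[OF assms, symmetric]
  by (simp_all add: swap_def mod_diff_left_eq algebra_simps)

lemma piece_swap:
  assumes "N > 0"
  shows "piece \<alpha> (swap \<alpha> \<beta> \<gamma>) = piece \<beta> \<gamma>" "piece \<beta> (swap \<alpha> \<beta> \<gamma>) = piece \<alpha> \<gamma>"
  unfolding piece_def shift_swap[OF assms] by (simp_all add: half_reflect shift_range[OF assms] del: atLeastLessThan_iff)

lemma colour_swap:
  assumes "N > 0"
  shows "colour \<alpha> (swap \<alpha> \<beta> \<gamma>) = colour \<beta> \<gamma>" "colour \<beta> (swap \<alpha> \<beta> \<gamma>) = colour \<alpha> \<gamma>"
  unfolding colour_def piece_swap[OF assms] by (auto simp: swap_def)

text \<open>Consequently \<open>unit \<alpha> \<gamma> * cnj (unit \<beta> \<gamma>)\<close> is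
  unchanged by \<open>swap\<close>, while the colours seen from the two rows are exchanged.\<close>

lemma unit_swap:
  assumes "N > 0"
  shows "unit \<alpha> (swap \<alpha> \<beta> \<gamma>) = cnj (unit \<beta> \<gamma>)" "unit \<beta> (swap \<alpha> \<beta> \<gamma>) = cnj (unit \<alpha> \<gamma>)"
  unfolding unit_def shift_swap[OF assms] U_reflect[OF shift_range[OF assms]]
  by (auto simp: swap_def intro!: arg_cong[where f = cnj] arg_cong2[where f = "\<lambda>a b. U a b _"])

lemma swap_blocks: "\<gamma> \<in> blocks \<Longrightarrow> swap \<alpha> \<beta> \<gamma> \<in> blocks"
  by (auto simp: blocks_def swap_def)

lemma swap_swap: "\<gamma> \<in> blocks \<Longrightarrow> swap \<alpha> \<beta> (swap \<alpha> \<beta> \<gamma>) = \<gamma>"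
  by (cases \<gamma>) (auto simp: blocks_def swap_def mod_diff_right_eq)

lemma colour_less: "\<gamma> \<in> blocks \<Longrightarrow> colour \<alpha> \<gamma> < 4 * p"
  using pc_less[OF half_less[OF shift_range[OF N_pos]], of \<gamma> \<alpha> \<gamma>] by (auto simp: colour_def piece_def)

lemma unit_units: "\<gamma> \<in> blocks \<Longrightarrow> unit \<alpha> \<gamma> \<in> quartic_units"
  unfolding unit_def by (intro U_units shift_range N_pos)

text \<open>The booleans are the two low binary digits of the colour, and the exclusive or with
  those of \<gamma> cancels.\<close>

lemma colour_eq_iff:
  "colour \<alpha> \<gamma> = colour \<beta> \<gamma> \<longleftrightarrow> piece \<alpha> \<gamma> = piece \<beta> \<gamma> \<and> snd \<alpha> = snd \<beta>"
  by (cases \<alpha>; cases \<beta>; cases \<gamma>) (auto simp: colour_def split: if_splits, presburger+)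

lemma design_entries:
  assumes "r \<in> indices" "c \<in> indices"
  shows "\<exists>q<p. design r c = x q \<or> design r c = - x q"
proof -
  have c: "fst c \<in> blocks" and m: "snd (snd r) < n" "snd (snd c) < n" using assms by (auto simp: indices_def)
  have "entry r c \<in> quartic_units" unfolding entry_def
    using M colour_less[OF c, of "fst r"] m unit_units[OF c]
    by (intro quartic_units_mult) (auto simp: anti_amicable_family_def)
  from realify_units[OF this, of "fst (snd r)" "fst (snd c)"] show ?thesis
    using pc_less[OF half_less[OF shift_range[OF N_pos[OF c]]], of "fst r" "fst c"]
    by (intro exI[of _ "piece (fst r) (fst c)"]) (auto simp: design_def \<phi>_1 \<phi>_minus piece_def)
qed

text \<open>
  The substitution \<open>swap\<close> exchanges the roles of the two rows, so after symmetrising, the terms of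
  differently coloured blocks cancel by anti-amicability.
\<close>

lemma twice_row_product:
  assumes r: "(\<alpha>, b, v) \<in> indices" and r': "(\<beta>, b', w) \<in> indices"
  shows "2 * (\<Sum>c\<in>indices. design (\<alpha>, b, v) c * design (\<beta>, b', w) c) =
    (\<Sum>\<gamma>\<in>blocks. if piece \<alpha> \<gamma> = piece \<beta> \<gamma> \<and> snd \<alpha> = snd \<beta> \<and> v = w
       then x (piece \<alpha> \<gamma>) ^ 2 * \<phi> (of_nat (4 * n) * re_part b b' (unit \<alpha> \<gamma> * cnj (unit \<beta> \<gamma>))) else 0)"
proof -
  let ?ip = "\<lambda>\<gamma>. row_ip n (M (colour \<alpha> \<gamma>)) (M (colour \<beta> \<gamma>)) v w"
  let ?ip' = "\<lambda>\<gamma>. row_ip n (M (colour \<beta> \<gamma>)) (M (colour \<alpha> \<gamma>)) v w"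
  let ?u = "\<lambda>\<gamma>. unit \<alpha> \<gamma> * cnj (unit \<beta> \<gamma>)"
  define T where "T \<gamma> = x (piece \<alpha> \<gamma>) * x (piece \<beta> \<gamma>) * \<phi> (2 * re_part b b' (?u \<gamma> * ?ip \<gamma>))" for \<gamma>
  have vw: "v < n" "w < n" and N: "N > 0" using r r' N_pos[of \<alpha>] by (auto simp: indices_def)
  have "(\<Sum>c\<in>indices. design (\<alpha>, b, v) c * design (\<beta>, b', w) c) =
     (\<Sum>\<gamma>\<in>blocks. \<Sum>c\<in>UNIV. \<Sum>j<n. design (\<alpha>, b, v) (\<gamma>, c, j) * design (\<beta>, b', w) (\<gamma>, c, j))"
    unfolding indices_def sum.cartesian_product by (intro sum.cong) auto
  also have "\<dots> = (\<Sum>\<gamma>\<in>blocks. T \<gamma>)"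
  proof (rule sum.cong[OF refl])
    fix \<gamma> assume "\<gamma> \<in> blocks"
    have "(\<Sum>c\<in>UNIV. \<Sum>j<n. design (\<alpha>, b, v) (\<gamma>, c, j) * design (\<beta>, b', w) (\<gamma>, c, j))
      = (\<Sum>j<n. \<Sum>c\<in>UNIV. design (\<alpha>, b, v) (\<gamma>, c, j) * design (\<beta>, b', w) (\<gamma>, c, j))"
      by (rule sum.swap)
    also have "\<dots> = x (piece \<alpha> \<gamma>) * x (piece \<beta> \<gamma>) * \<phi> (\<Sum>j<n. \<Sum>c\<in>UNIV.
        realify b c (entry (\<alpha>, b, v) (\<gamma>, c, j)) * realify b' c (entry (\<beta>, b', w) (\<gamma>, c, j)))"
      unfolding \<phi>_sum sum_distrib_left by (intro sum.cong refl) (simp add: design_def \<phi>_mult algebra_simps)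
    also have "(\<Sum>j<n. \<Sum>c\<in>UNIV. realify b c (entry (\<alpha>, b, v) (\<gamma>, c, j)) * realify b' c (entry (\<beta>, b', w) (\<gamma>, c, j)))
       = (\<Sum>j<n. 2 * re_part b b' (?u \<gamma> * (M (colour \<alpha> \<gamma>) v j * cnj (M (colour \<beta> \<gamma>) w j))))"
    proof (rule sum.cong[OF refl])
      fix j
      have "(\<Sum>c\<in>UNIV. realify b c (entry (\<alpha>, b, v) (\<gamma>, c, j)) * realify b' c (entry (\<beta>, b', w) (\<gamma>, c, j)))
        = (\<Sum>c\<in>UNIV. realify b c (unit \<alpha> \<gamma> * M (colour \<alpha> \<gamma>) v j) * realify b' c (unit \<beta> \<gamma> * M (colour \<beta> \<gamma>) w j))"
        by (simp add: entry_def)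
      also have "\<dots> = 2 * re_part b b' (?u \<gamma> * (M (colour \<alpha> \<gamma>) v j * cnj (M (colour \<beta> \<gamma>) w j)))"
        unfolding realify_mult by (simp add: algebra_simps)
      finally show "(\<Sum>c\<in>UNIV. realify b c (entry (\<alpha>, b, v) (\<gamma>, c, j)) * realify b' c (entry (\<beta>, b', w) (\<gamma>, c, j)))
        = 2 * re_part b b' (?u \<gamma> * (M (colour \<alpha> \<gamma>) v j * cnj (M (colour \<beta> \<gamma>) w j)))" .
    qed
    also have "\<dots> = 2 * re_part b b' (?u \<gamma> * ?ip \<gamma>)"
      unfolding row_ip_def sum_distrib_left[symmetric] re_part_sum[symmetric] ..
    finally show "(\<Sum>c\<in>UNIV. \<Sum>j<n. design (\<alpha>, b, v) (\<gamma>, c, j) * design (\<beta>, b', w) (\<gamma>, c, j)) = T \<gamma>"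
      unfolding T_def .
  qed
  finally have 1: "(\<Sum>c\<in>indices. design (\<alpha>, b, v) c * design (\<beta>, b', w) c) = sum T blocks" .
  have "sum T blocks = (\<Sum>\<gamma>\<in>blocks. T (swap \<alpha> \<beta> \<gamma>))"
    by (rule sum.reindex_bij_witness[of _ "swap \<alpha> \<beta>" "swap \<alpha> \<beta>"]) (auto simp: swap_blocks swap_swap)
  then have "2 * sum T blocks = (\<Sum>\<gamma>\<in>blocks. T \<gamma> + T (swap \<alpha> \<beta> \<gamma>))"
    by (simp add: sum.distrib)
  also have "\<dots> = (\<Sum>\<gamma>\<in>blocks. if piece \<alpha> \<gamma> = piece \<beta> \<gamma> \<and> snd \<alpha> = snd \<beta> \<and> v = w
       then x (piece \<alpha> \<gamma>) ^ 2 * \<phi> (of_nat (4 * n) * re_part b b' (?u \<gamma>)) else 0)"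
  proof (rule sum.cong[OF refl])
    fix \<gamma> assume \<gamma>: "\<gamma> \<in> blocks"
    have "T \<gamma> + T (swap \<alpha> \<beta> \<gamma>) = x (piece \<alpha> \<gamma>) * x (piece \<beta> \<gamma>)
       * \<phi> (2 * re_part b b' (?u \<gamma> * (?ip \<gamma> + ?ip' \<gamma>)))"
      unfolding T_def piece_swap[OF N] unit_swap[OF N] colour_swap[OF N]
      by (simp add: distrib_left re_part_add \<phi>_add algebra_simps)
    also have "?ip \<gamma> + ?ip' \<gamma> = (if colour \<alpha> \<gamma> = colour \<beta> \<gamma> \<and> v = w then of_nat (2 * n) else 0)"
      using M colour_less[OF \<gamma>] vw unfolding anti_amicable_family_def by blast
    also have "2 * re_part b b' (?u \<gamma> * (if colour \<alpha> \<gamma> = colour \<beta> \<gamma> \<and> v = w then of_nat (2 * n) else 0))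
       = (if colour \<alpha> \<gamma> = colour \<beta> \<gamma> \<and> v = w then of_nat (4 * n) * re_part b b' (?u \<gamma>) else 0)"
      using re_part_of_nat[of b b' "2 * n" "?u \<gamma>"] by (simp add: mult.commute) (simp add: re_part_def)
    finally show "T \<gamma> + T (swap \<alpha> \<beta> \<gamma>) = (if piece \<alpha> \<gamma> = piece \<beta> \<gamma> \<and> snd \<alpha> = snd \<beta> \<and> v = w
       then x (piece \<alpha> \<gamma>) ^ 2 * \<phi> (of_nat (4 * n) * re_part b b' (?u \<gamma>)) else 0)"
      unfolding colour_eq_iff by (auto simp: \<phi>_0 power2_eq_square)
  qed
  finally show ?thesis unfolding 1 .
qed

text \<open>Substituting the difference of \<gamma> and \<alpha> gives the periodic correlation at
  shift \<open>h\<close>. For \<open>h = 0\<close> each position of the piece counts twice by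
  reflection and four times by the booleans, hence the 8.\<close>

lemma unit_sum:
  assumes \<alpha>: "\<alpha> \<in> blocks" and \<beta>: "\<beta> \<in> blocks" and e: "snd \<alpha> = snd \<beta>"
  shows "(\<Sum>\<gamma>\<in>blocks. if piece \<alpha> \<gamma> = q \<and> piece \<beta> \<gamma> = q then unit \<alpha> \<gamma> * cnj (unit \<beta> \<gamma>) else 0)
    = (if \<alpha> = \<beta> then of_nat (8 * card {i. i < s \<and> pc i = q}) else 0)"
proof -
  obtain g g' f f' where ab: "\<alpha> = (g, f, f')" "\<beta> = (g', f, f')" using e by (metis prod.collapse)
  have g: "g \<in> {0..<N}" "g' \<in> {0..<N}" using \<alpha> \<beta> by (auto simp: blocks_def ab)
  have N: "N > 0" using \<alpha> by (rule N_pos)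
  define h where "h = (g - g') mod N"
  have t': "(a - g') mod N = ((a - g) mod N + h) mod N" for a
    unfolding h_def by (simp add: mod_add_eq)
  have "(\<Sum>\<gamma>\<in>blocks. if piece \<alpha> \<gamma> = q \<and> piece \<beta> \<gamma> = q then unit \<alpha> \<gamma> * cnj (unit \<beta> \<gamma>) else 0)
    = (\<Sum>(t, e, e')\<in>blocks. if pc (half t) = q \<and> pc (half ((t + h) mod N)) = q
        then U e e' t * cnj (U e e' ((t + h) mod N)) else 0)"
    by (rule sum.reindex_bij_witness[of _ "\<lambda>(t, e, e'). ((t + g) mod N, e \<noteq> f, e' \<noteq> f')" "\<lambda>(a, k, k'). ((a - g) mod N, k \<noteq> f, k' \<noteq> f')"])
      (use N in \<open>auto simp: blocks_def ab piece_def unit_def shift_def t' mod_diff_left_eq mod_add_left_eq\<close>)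
  also have "\<dots> = (\<Sum>t\<in>{0..<N}. \<Sum>e\<in>UNIV. \<Sum>e'\<in>UNIV. if pc (half t) = q \<and> pc (half ((t + h) mod N)) = q
        then U e e' t * cnj (U e e' ((t + h) mod N)) else 0)"
    unfolding blocks_def by (simp only: sum.cartesian_product)
  also have "\<dots> = (\<Sum>t\<in>{0..<N}. if pc (half t) = q \<and> pc (half ((t + h) mod N)) = q
        then \<Sum>e\<in>UNIV. \<Sum>e'\<in>UNIV. U e e' t * cnj (U e e' ((t + h) mod N)) else 0)"
    by (intro sum.cong) auto
  also have "\<dots> = (if \<alpha> = \<beta> then of_nat (8 * card {i. i < s \<and> pc i = q}) else 0)"
  proof (cases "g = g'")
    case True
    have "(\<Sum>t\<in>{0..<N}. if pc (half t) = q \<and> pc (half ((t + h) mod N)) = q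
        then \<Sum>e\<in>UNIV. \<Sum>e'\<in>UNIV. U e e' t * cnj (U e e' ((t + h) mod N)) else 0)
      = (\<Sum>t\<in>{0..<N}. 4 * (if pc (half t) = q then 1 else 0))"
      using True by (intro sum.cong) (auto simp: h_def UNIV_bool quartic_units_norm U_units)
    also have "\<dots> = of_nat (8 * card {i. i < s \<and> pc i = q})"
      unfolding sum_distrib_left[symmetric] card_half by simp
    finally show ?thesis using True ab by simp
  next
    case False
    have "h \<noteq> 0"
    proof
      assume "h = 0"
      then have "g mod N = g' mod N" by (simp add: h_def mod_eq_dvd_iff dvd_eq_mod_eq_0)
      then show False using False g by simp
    qed
    moreover have "0 \<le> h" "h < N" using N by (auto simp: h_def)
    ultimately have "h \<in> {1..<N}" by simp
    from same_colour_sum[OF this] show ?thesis using False ab by simp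
  qed
  finally show ?thesis .
qed

text \<open>For rows that agree in the two block booleans and in the row of \<open>M\<close>,
  sorting the blocks by piece leaves the sums of \<open>unit_sum\<close>; the doubled product
  carries the weight \<open>4 n * 8 = 2 * 16 n\<close>. All other products vanish by
  anti-amicability.\<close>

theorem design_orthogonal:
  assumes r: "r \<in> indices" and r': "r' \<in> indices"
  shows "(\<Sum>c\<in>indices. design r c * design r' c) =
    (if r = r' then \<Sum>q<p. of_nat (16 * n * card {i. i < s \<and> pc i = q}) * x q ^ 2 else 0)"
proof -
  obtain \<alpha> b v \<beta> b' w where rr: "r = (\<alpha>, b, v)" "r' = (\<beta>, b', w)" by (cases r; cases r') auto
  have ab: "\<alpha> \<in> blocks" "\<beta> \<in> blocks" using r r' by (auto simp: rr indices_def)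
  let ?R = "\<Sum>q<p. of_nat (16 * n * card {i. i < s \<and> pc i = q}) * x q ^ 2"
  have "2 * (\<Sum>c\<in>indices. design r c * design r' c) = 2 * (if r = r' then ?R else 0)"
  proof (cases "snd \<alpha> = snd \<beta> \<and> v = w")
    case False
    then show ?thesis using twice_row_product r r' by (auto simp: rr)
  next
    case True
    let ?u = "\<lambda>\<gamma>. unit \<alpha> \<gamma> * cnj (unit \<beta> \<gamma>)"
    have fin: "finite blocks" by (simp add: blocks_def)
    have "2 * (\<Sum>c\<in>indices. design r c * design r' c) =
      (\<Sum>\<gamma>\<in>blocks. if piece \<alpha> \<gamma> = piece \<beta> \<gamma>
       then x (piece \<alpha> \<gamma>) ^ 2 * \<phi> (of_nat (4 * n) * re_part b b' (?u \<gamma>)) else 0)"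
      using twice_row_product r r' True by (simp add: rr)
    also have "\<dots> = (\<Sum>\<gamma>\<in>blocks. \<Sum>q<p. if piece \<alpha> \<gamma> = q \<and> piece \<beta> \<gamma> = q
       then x q ^ 2 * \<phi> (of_nat (4 * n) * re_part b b' (?u \<gamma>)) else 0)"
    proof (rule sum.cong[OF refl])
      fix \<gamma> assume \<gamma>: "\<gamma> \<in> blocks"
      have "piece \<alpha> \<gamma> < p" using colour_less[OF \<gamma>, of \<alpha>] by (auto simp: colour_def)
      then show "(if piece \<alpha> \<gamma> = piece \<beta> \<gamma> then x (piece \<alpha> \<gamma>) ^ 2 * \<phi> (of_nat (4 * n) * re_part b b' (?u \<gamma>)) else 0)
        = (\<Sum>q<p. if piece \<alpha> \<gamma> = q \<and> piece \<beta> \<gamma> = q then x q ^ 2 * \<phi> (of_nat (4 * n) * re_part b b' (?u \<gamma>)) else 0)"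
        by (subst sum.remove[of "{..<p}" "piece \<alpha> \<gamma>"]) (auto intro!: sum.neutral)
    qed
    also have "\<dots> = (\<Sum>q<p. x q ^ 2 * \<phi> (of_nat (4 * n) * re_part b b'
         (\<Sum>\<gamma>\<in>blocks. if piece \<alpha> \<gamma> = q \<and> piece \<beta> \<gamma> = q then ?u \<gamma> else 0)))"
      unfolding re_part_sum sum_distrib_left \<phi>_sum
      by (subst sum.swap) (auto intro!: sum.cong simp: \<phi>_0 re_part_def)
    also have "\<dots> = (\<Sum>q<p. x q ^ 2 * \<phi> (of_nat (4 * n) * re_part b b'
         (if \<alpha> = \<beta> then of_nat (8 * card {i. i < s \<and> pc i = q}) else 0)))"
      using unit_sum[OF ab] True by simp
    also have "\<dots> = 2 * (if r = r' then ?R else 0)"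
    proof (cases "r = r'")
      case eq: True
      have "\<phi> (of_nat (4 * n) * re_part b b' (of_nat (8 * card {i. i < s \<and> pc i = q})))
        = of_nat (2 * (16 * n * card {i. i < s \<and> pc i = q}))" for q
      proof -
        have "of_nat (4 * n) * re_part b b' (of_nat (8 * card {i. i < s \<and> pc i = q}))
           = (of_nat (2 * (16 * n * card {i. i < s \<and> pc i = q})) :: real)"
          using eq by (simp add: re_part_def rr)
        then show ?thesis by (simp only: \<phi>_of_nat)
      qed
      then show ?thesis using eq by (simp add: rr sum_distrib_left mult_ac)
    next
      case False
      then have "re_part b b' (if \<alpha> = \<beta> then of_nat c else 0) = 0" for c
        using True by (auto simp: re_part_def rr)
      then show ?thesis using False by (simp add: \<phi>_0)
    qed
    finally show ?thesis .
  qed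
  \<comment> \<open>The factor 2 can be removed in the target ring because
    \<open>\<phi> (1/2)\<close> is its inverse.\<close>
  then have "\<phi> (1/2) * (2 * (\<Sum>c\<in>indices. design r c * design r' c)) = \<phi> (1/2) * (2 * (if r = r' then ?R else 0))"
    by (rule arg_cong)
  moreover have "\<phi> (1/2) * (2 * y) = y" for y
    using \<phi>_mult[of "1/2" 2] \<phi>_of_nat[of 2] by (simp add: \<phi>_1 mult.assoc[symmetric])
  ultimately show ?thesis by (simp only:)
qed

lemma card_indices: "card indices = 16 * s * n"
proof -
  have "nat N = 2 * s" by (simp add: N_def)
  then show ?thesis by (simp add: indices_def blocks_def card_cartesian_product UNIV_bool)
qed

end

section \<open>Concatenating Golay pairs and assembling the orthogonal design\<close>

lemma sum_lessThan_add: "(\<Sum>i<m + n. f i) = (\<Sum>i<m. f i) + (\<Sum>i<n. f (i + m :: nat))"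
  for f :: "nat \<Rightarrow> 'a::comm_monoid_add"
  by (induction n) (simp_all add: ac_simps)

text \<open>The new pair forms a piece of its own, numbered \<open>p\<close>; \<open>corr\<close>
  counts only products within one piece, so nothing crosses the seam.\<close>

lemma golay_layout_append:
  assumes L: "golay_layout s p A B pc" and g: "golay_pair m a b"
  defines "A' \<equiv> \<lambda>i. if i < s then A i else a (i - s)"
    and "B' \<equiv> \<lambda>i. if i < s then B i else b (i - s)"
    and "pc' \<equiv> \<lambda>i. if i < s then pc i else p"
  shows "golay_layout (s + m) (Suc p) A' B' pc'"
proof
  fix i assume i: "i < s + m"
  show "A' i \<in> quartic_units" "B' i \<in> quartic_units" "pc' i < Suc p"
    using i g golay_layout.units[OF L, of i] golay_layout.pc_less[OF L, of i]
    by (auto simp: A'_def B'_def pc'_def golay_pair_def)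
next
  fix j q :: nat assume j: "1 \<le> j"
  let ?f = "\<lambda>i. if i + j < s + m \<and> pc' i = q \<and> pc' (i + j) = q
        then A' (i + j) * cnj (A' i) + B' (i + j) * cnj (B' i) else 0"
  have pc: "i < s \<Longrightarrow> pc i < p" for i using golay_layout.pc_less[OF L] .
  have "(\<Sum>i<s + m. ?f i) = (\<Sum>i<s. ?f i) + (\<Sum>i<m. ?f (i + s))"
    by (rule sum_lessThan_add)
  also have "(\<Sum>i<s. ?f i) = (\<Sum>i<s. if i + j < s \<and> pc i = q \<and> pc (i + j) = q
        then A (i + j) * cnj (A i) + B (i + j) * cnj (B i) else 0)"
    using pc by (intro sum.cong) (auto simp: A'_def B'_def pc'_def)
  also have "\<dots> = 0" using golay_layout.corr[OF L j] .
  also have "(\<Sum>i<m. ?f (i + s)) = (if q = p then (\<Sum>i<m - j. a (i + j) * cnj (a i) + b (i + j) * cnj (b i)) else 0)"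
  proof (cases "q = p")
    case True
    have "(\<Sum>i<m. ?f (i + s)) = (\<Sum>i<m - j. a (i + j) * cnj (a i) + b (i + j) * cnj (b i))"
      using True by (intro sum.mono_neutral_cong_right) (auto simp: A'_def B'_def pc'_def)
    then show ?thesis using True by simp
  qed (auto simp: pc'_def intro!: sum.neutral)
  also have "\<dots> = 0" using g j by (simp add: golay_pair_def acorr_def sum.distrib)
  finally show "(\<Sum>i<s + m. ?f i) = 0" by simp
qed

lemma golay_layout_exists:
  assumes "\<forall>m\<in>set ms. complex_golay_number m"
  shows "\<exists>A B pc. golay_layout (sum_list ms) (length ms) A B pc \<and>
    (\<forall>q<length ms. card {i. i < sum_list ms \<and> pc i = q} = ms ! q)"
  using assms
\<comment> \<open>New pairs are appended at the end, so piece \<open>q\<close> keeps belonging to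
  \<open>ms ! q\<close>.\<close>
proof (induction ms rule: rev_induct)
  case Nil
  have "golay_layout 0 0 A B pc" for A B pc by unfold_locales auto
  then show ?case by auto
next
  case (snoc m ms)
  then obtain A B pc where L: "golay_layout (sum_list ms) (length ms) A B pc"
    and card: "\<forall>q<length ms. card {i. i < sum_list ms \<and> pc i = q} = ms ! q" by auto
  from snoc.prems obtain a b where "golay_pair m a b" by (auto simp: complex_golay_number_iff)
  note L' = golay_layout_append[OF L this]
  let ?s = "sum_list ms"
  let ?pc = "\<lambda>i. if i < ?s then pc i else length ms"
  have pc: "i < ?s \<Longrightarrow> pc i < length ms" for i using golay_layout.pc_less[OF L] .
  have "card {i. i < ?s + m \<and> ?pc i = q} = (ms @ [m]) ! q" if "q < Suc (length ms)" for q
  proof (cases "q = length ms")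
    case True
    have "i \<in> {i. i < ?s + m \<and> ?pc i = q} \<longleftrightarrow> i \<in> {?s..<?s + m}" for i
      using pc[of i] True by auto
    then have "{i. i < ?s + m \<and> ?pc i = q} = {?s..<?s + m}" by blast
    then show ?thesis using True by simp
  next
    case False
    then have "{i. i < ?s + m \<and> ?pc i = q} = {i. i < ?s \<and> pc i = q}" by auto
    then show ?thesis using False that card by (simp add: nth_append)
  qed
  then have "\<forall>q<length (ms @ [m]). card {i. i < sum_list (ms @ [m]) \<and> ?pc i = q} = (ms @ [m]) ! q"
    by simp
  moreover have "golay_layout (sum_list (ms @ [m])) (length (ms @ [m])) (\<lambda>i. if i < ?s then A i else a (i - ?s))
      (\<lambda>i. if i < ?s then B i else b (i - ?s)) ?pc"
    using L' by simp
  ultimately show ?case by blast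
qed

lemma anti_amicable_family_mono:
  "anti_amicable_family q n M \<Longrightarrow> q' \<le> q \<Longrightarrow> anti_amicable_family q' n M"
  by (auto simp: anti_amicable_family_def)

lemma orthogonal_design_from_pieces:
  fixes ps :: "(nat \<times> nat) list"
  assumes golay: "\<forall>(i, m)\<in>set ps. i \<in> {1..k} \<and> complex_golay_number m"
    and v: "\<And>i. i \<in> {1..k} \<Longrightarrow> 0 < v i \<and> (\<Sum>(a, m)\<leftarrow>ps. if a = i then m else 0) = v i"
    and "ps \<noteq> []" and n: "2 * length ps + 3 \<le> n"
  shows "\<exists>X. orthogonal_design (2 ^ n * (\<Sum>j=1..k. v j)) k (\<lambda>j. 2 ^ n * v j) X"
proof -
  define ms where "ms = map snd ps"
  define s where "s = sum_list ms"
  have len: "length ms = length ps" by (simp add: ms_def)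
  obtain A B pc where L: "golay_layout s (length ps) A B pc"
    and card: "\<And>q. q < length ps \<Longrightarrow> card {i. i < s \<and> pc i = q} = snd (ps ! q)"
  proof -
    have "\<forall>m\<in>set ms. complex_golay_number m" using golay by (auto simp: ms_def)
    from golay_layout_exists[OF this] that show ?thesis
      unfolding s_def[symmetric] len by (auto simp: ms_def)
  qed
  \<comment> \<open>The index set has \<open>16 * s * d\<close> elements, which fixes
    \<open>d\<close>. A family of order \<open>d\<close> has \<open>2 * (n - 4) + 2\<close> members,
    and the bound on \<open>n\<close> makes this at least \<open>4 * length ps\<close>.\<close>
  define d where "d = (2::nat) ^ (n - 4)"
  have "length ps \<ge> 1" using \<open>ps \<noteq> []\<close> by (cases ps) auto
  then have "n = 4 + (n - 4)" and le: "4 * length ps \<le> 2 * (n - 4) + 2" using n by auto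
  then have d: "16 * d = 2 ^ n" using power_add[of "2::nat" 4 "n - 4"] by (simp add: d_def)
  obtain M where "anti_amicable_family (2 * (n - 4) + 2) d M"
    using anti_amicable_family_exists[of "n - 4"] by (auto simp: d_def)
  then have M: "anti_amicable_family (4 * length ps) d M"
    using le by (rule anti_amicable_family_mono)
  define x where "x q = var (fst (ps ! q))" for q
  interpret golay_design s "length ps" A B pc "Poly_Mapping.single 0 :: real \<Rightarrow> real_mpoly" d M x
    by (intro golay_design.intro L golay_design_axioms.intro M)
      (unfold_locales, simp_all add: single_add mult_single)
  have sum_ps: "(\<Sum>q<length ps. f (ps ! q)) = (\<Sum>y\<leftarrow>ps. f y)" for f :: "nat \<times> nat \<Rightarrow> 'b::comm_monoid_add"
    by (simp add: sum_list_sum_nth lessThan_atLeast0)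
  have s: "s = (\<Sum>j=1..k. v j)"
  proof -
    have "(\<Sum>j=1..k. v j) = (\<Sum>j=1..k. \<Sum>y\<leftarrow>ps. if fst y = j then snd y else 0)"
      using v by (intro sum.cong) (auto simp: case_prod_unfold)
    also have "\<dots> = (\<Sum>y\<leftarrow>ps. \<Sum>j=1..k. if fst y = j then snd y else 0)"
      unfolding sum_ps[symmetric] by (rule sum.swap)
    also have "\<dots> = s" unfolding s_def ms_def
      using golay by (intro arg_cong[where f = sum_list] map_cong) auto
    finally show ?thesis ..
  qed
  \<comment> \<open>Pieces with the same first component carry the same variable, so their weights
    add up to \<open>v i\<close>.\<close>
  have rhs: "(\<Sum>q<length ps. of_nat (16 * d * card {i. i < s \<and> pc i = q}) * x q ^ 2)
     = (\<Sum>i=1..k. of_nat (2 ^ n * v i) * (var i)\<^sup>2)"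
  proof -
    have "(\<Sum>q<length ps. of_nat (16 * d * card {i. i < s \<and> pc i = q}) * x q ^ 2)
      = (\<Sum>q<length ps. of_nat (2 ^ n * snd (ps ! q)) * (var (fst (ps ! q)))\<^sup>2)"
      unfolding d by (intro sum.cong) (auto simp: card x_def)
    also have "\<dots> = (\<Sum>q<length ps. \<Sum>i=1..k. of_nat (2 ^ n * (if fst (ps ! q) = i then snd (ps ! q) else 0)) * (var i)\<^sup>2)"
    proof (rule sum.cong[OF refl])
      fix q assume "q \<in> {..<length ps}"
      then have "fst (ps ! q) \<in> {1..k}" using golay nth_mem by fastforce
      then have "(\<Sum>i=1..k. if i = fst (ps ! q) then of_nat (2 ^ n * snd (ps ! q)) * (var i)\<^sup>2 else 0)
        = of_nat (2 ^ n * snd (ps ! q)) * (var (fst (ps ! q)))\<^sup>2" by simp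
      moreover have "of_nat (2 ^ n * (if fst (ps ! q) = i then snd (ps ! q) else 0)) * (var i)\<^sup>2
        = (if i = fst (ps ! q) then of_nat (2 ^ n * snd (ps ! q)) * (var i)\<^sup>2 else 0)" for i by simp
      ultimately show "of_nat (2 ^ n * snd (ps ! q)) * (var (fst (ps ! q)))\<^sup>2
         = (\<Sum>i=1..k. of_nat (2 ^ n * (if fst (ps ! q) = i then snd (ps ! q) else 0)) * (var i)\<^sup>2)"
        by (simp only:)
    qed
    also have "\<dots> = (\<Sum>i=1..k. of_nat (2 ^ n * (\<Sum>q<length ps. if fst (ps ! q) = i then snd (ps ! q) else 0)) * (var i)\<^sup>2)"
      unfolding of_nat_mult of_nat_sum sum_distrib_left sum_distrib_right by (rule sum.swap)
    also have "\<dots> = (\<Sum>i=1..k. of_nat (2 ^ n * v i) * (var i)\<^sup>2)"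
    proof (rule sum.cong[OF refl])
      fix i assume "i \<in> {1..k}"
      then have "(\<Sum>q<length ps. if fst (ps ! q) = i then snd (ps ! q) else 0) = v i"
        using v[of i] sum_ps[of "\<lambda>y. if fst y = i then snd y else 0"] by (simp add: case_prod_unfold)
      then show "of_nat (2 ^ n * (\<Sum>q<length ps. if fst (ps ! q) = i then snd (ps ! q) else 0)) * (var i)\<^sup>2
        = of_nat (2 ^ n * v i) * (var i)\<^sup>2" by simp
    qed
    finally show ?thesis .
  qed
  define m where "m = 2 ^ n * (\<Sum>j=1..k. v j)"
  have fin: "finite indices" by (simp add: indices_def blocks_def)
  have "m = 16 * s * d" unfolding m_def d[symmetric] s[symmetric] by simp
  then have "card indices = m" by (simp only: card_indices)
  \<comment> \<open>Any enumeration of the index set will do: it is applied to rows and columns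
    alike.\<close>
  then obtain h where h: "bij_betw h {0..<m} indices"
    using ex_bij_betw_nat_finite[OF fin] by auto
  define X where "X = mat m m (\<lambda>(r, c). design (h r) (h c))"
  have X: "X \<in> carrier_mat m m" by (simp add: X_def)
  have "orthogonal_design m k (\<lambda>j. 2 ^ n * v j) X"
    unfolding orthogonal_design_def
  proof (intro conjI ballI allI impI)
    fix r c assume rc: "r < m" "c < m"
    then have "h r \<in> indices" "h c \<in> indices" using h by (auto simp: bij_betw_def)
    from design_entries[OF this] obtain q where "q < length ps"
      and e: "design (h r) (h c) = x q \<or> design (h r) (h c) = - x q" by blast
    then have "fst (ps ! q) \<in> {1..k}" using golay nth_mem by fastforce
    then show "X $$ (r, c) \<in> {0} \<union> var ` {1..k} \<union> (\<lambda>i. - var i) ` {1..k}"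
      using e rc by (auto simp: X_def x_def)
  next
    show "X * transpose_mat X = (\<Sum>i=1..k. of_nat (2 ^ n * v i) * (var i)\<^sup>2) \<cdot>\<^sub>m 1\<^sub>m m"
    proof (rule eq_matI)
      fix r c
      assume "r < dim_row ((\<Sum>i=1..k. of_nat (2 ^ n * v i) * (var i)\<^sup>2) \<cdot>\<^sub>m 1\<^sub>m m)"
        and "c < dim_col ((\<Sum>i=1..k. of_nat (2 ^ n * v i) * (var i)\<^sup>2) \<cdot>\<^sub>m 1\<^sub>m m)"
      then have rc: "r < m" "c < m" by simp_all
      then have hrc: "h r \<in> indices" "h c \<in> indices" "h r = h c \<longleftrightarrow> r = c"
        using h by (auto simp: bij_betw_def inj_on_def)
      have "(X * transpose_mat X) $$ (r, c) = (\<Sum>j\<in>{0..<m}. design (h r) (h j) * design (h c) (h j))"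
        using rc by (simp add: X_def scalar_prod_def)
      also have "\<dots> = (\<Sum>j\<in>indices. design (h r) j * design (h c) j)"
        by (rule sum.reindex_bij_betw[OF h])
      also have "\<dots> = ((\<Sum>i=1..k. of_nat (2 ^ n * v i) * (var i)\<^sup>2) \<cdot>\<^sub>m 1\<^sub>m m) $$ (r, c)"
        unfolding design_orthogonal[OF hrc(1,2)] rhs using rc hrc(3) by simp
      finally show "(X * transpose_mat X) $$ (r, c) = ((\<Sum>i=1..k. of_nat (2 ^ n * v i) * (var i)\<^sup>2) \<cdot>\<^sub>m 1\<^sub>m m) $$ (r, c)" .
    qed (use X in auto)
  next
    fix i assume "i \<in> {1..k}"
    then show "0 < 2 ^ n * v i" using v by simp
  qed (fact X)
  then show ?thesis unfolding m_def by blast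
qed

lemma sum_list_map_concat: "sum_list (map f (concat xss)) = (\<Sum>xs\<leftarrow>xss. sum_list (map f xs))"
  by (induction xss) auto

theorem theorem10:
  fixes k :: nat and v :: "nat \<Rightarrow> nat"
  assumes "1 \<le> k"
    and "\<forall>i\<in>{1..k}. 0 < v i"
    and "\<forall>i\<in>{2..k}. int (lc (v 1)) - int (lc (v 1 - 1)) \<ge> int (lc (v i)) - int (lc (v i - 1))"
  shows "\<exists>N::nat.
      real N \<le> 1/5 * lg (v 1 - 1) + 1/5 * (\<Sum>i=2..k. lg (v i)) + 10 * real k + 4 \<and>
      (\<forall>n\<ge>N. \<exists>X. orthogonal_design (2^n * (\<Sum>j=1..k. v j)) k (\<lambda>j. 2^n * v j) X)"
proof -
  have "\<forall>i\<in>{1..k}. \<exists>ms. real (length ms) \<le> lg (v i) / 10 + 5 \<and>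
      (\<forall>m\<in>set ms. complex_golay_number m) \<and> sum_list ms = v i"
    using assms(2) golay_list_short by blast
  then obtain L where L: "\<And>i. i \<in> {1..k} \<Longrightarrow> real (length (L i)) \<le> lg (v i) / 10 + 5 \<and>
      (\<forall>m\<in>set (L i). complex_golay_number m) \<and> sum_list (L i) = v i"
    by metis
  define ps where "ps = concat (map (\<lambda>i. map (Pair i) (L i)) [1..<Suc k])"
  have sum_ps: "(\<Sum>y\<leftarrow>ps. f y) = (\<Sum>i=1..k. \<Sum>m\<leftarrow>L i. f (i, m))" for f :: "nat \<times> nat \<Rightarrow> nat"
    unfolding ps_def sum_list_map_concat map_map comp_def
    by (simp add: interv_sum_list_conv_sum_set_nat comp_def atLeastLessThanSuc_atLeastAtMost del: upt_Suc)
  have "length ps = (\<Sum>i=1..k. length (L i))"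
    using sum_ps[of "\<lambda>_. 1"] by (simp add: sum_list_triv)
  then have "2 * real (length ps) = 2 * (\<Sum>i=1..k. real (length (L i)))" by simp
  also have "\<dots> \<le> 2 * (\<Sum>i=1..k. lg (v i) / 10 + 5)"
    using L by (intro mult_left_mono sum_mono) auto
  also have "\<dots> = 1/5 * (\<Sum>i=1..k. lg (v i)) + 10 * real k"
    by (simp add: sum.distrib sum_divide_distrib[symmetric])
  also have "(\<Sum>i=1..k. lg (v i)) = lg (v 1) + (\<Sum>i=2..k. lg (v i))"
    using assms(1) by (simp add: sum.atLeast_Suc_atMost numeral_2_eq_2)
  \<comment> \<open>Doubling \<open>lg / 10 + 5\<close> gives the factor 1/5 and the 10 per
    variable. Passing from \<open>lg (v 1)\<close> to \<open>lg (v 1 - 1)\<close> costs at most 1/5,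
    and \<open>3 + 1/5 \<le> 4\<close>.\<close>
  finally have "real (2 * length ps + 3) \<le> 1/5 * lg (v 1 - 1) + 1/5 * (\<Sum>i=2..k. lg (v i)) + 10 * real k + 4"
    using lg_pred[of "v 1"] assms(1,2) by (simp add: algebra_simps)
  moreover have "\<exists>X. orthogonal_design (2 ^ n * (\<Sum>j=1..k. v j)) k (\<lambda>j. 2 ^ n * v j) X"
    if "n \<ge> 2 * length ps + 3" for n
  proof (rule orthogonal_design_from_pieces)
    show "\<forall>(i, m)\<in>set ps. i \<in> {1..k} \<and> complex_golay_number m"
    proof
      fix y assume "y \<in> set ps"
      then obtain i m where "y = (i, m)" "i \<in> {1..k}" "m \<in> set (L i)"
        by (auto simp: ps_def)
      then show "case y of (i, m) \<Rightarrow> i \<in> {1..k} \<and> complex_golay_number m"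
        using L by blast
    qed
    have sum_v: "(\<Sum>(a, m)\<leftarrow>ps. if a = i then m else 0) = v i" if i: "i \<in> {1..k}" for i
    proof -
      have "(\<Sum>(a, m)\<leftarrow>ps. if a = i then m else 0) = (\<Sum>j=1..k. if j = i then sum_list (L j) else 0)"
        unfolding sum_ps by (intro sum.cong) auto
      then show ?thesis using i L by simp
    qed
    then show "0 < v i \<and> (\<Sum>(a, m)\<leftarrow>ps. if a = i then m else 0) = v i" if "i \<in> {1..k}" for i
      using assms(2) that by blast
    have "1 \<in> {1..k}" using assms(1) by simp
    then have "v 1 \<noteq> 0" using assms(2) by blast
    then show "ps \<noteq> []" using sum_v[OF \<open>1 \<in> {1..k}\<close>] by auto
    show "2 * length ps + 3 \<le> n" by fact
  qed
  ultimately show ?thesis by blast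
qed

end
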